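(* Let $\mathcal M=(M,<,+,\cdot,\ldots)$ be an o-minimal expansion of a real closed field. Let $G$ be a definable group, equipped with its definable manifold topology, and let $H<G$ be a definable subgroup (not necessarily normal). Let $\tau$ be a topology on $G/H$ such that $(G/H,\tau)$ is a definable manifold and the action $L\colon G\times G/H\to G/H$, $L(g_1,g_2H)=g_1g_2H$, is continuous. Then $\tau$ coincides with the quotient topology $\nu$ on $G/H$ induced by the projection $G\to G/H$. Moreover, if $H$ is normal in $G$, then the definable manifold topology of the definable group $G/H$ also coincides with $\nu$ (and hence with $\tau$).
   Context: "Definable" means first-order definable in $\mathcal M$ with parameters. A definable manifold of dimension $n$ is a definable set $X$ with a topology admitting a finite cover by definable open sets $U_i$ and definable homeomorphisms of the $U_i$ onto open subsets of $M^n$ ($M$ with the order topology). A definable group is a definable set with a definable group operation; it has a unique topology (its definable manifold topology) making it a topological group and a definable manifold of dimension $\dim G$. By definable choice $G/H$ is identified with a definable set (via a definable map $\iota$ on $G$ with $\iota(g)=\iota(h)$ iff $gH=hH$). A topology $\tau$ as in the statement exists. *)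

theory Defs
  imports "HOL-Analysis.Analysis" "HOL-Algebra.Coset" "HOL-Computational_Algebra.Polynomial"
begin

type_synonym 'a tup = "nat \<Rightarrow> 'a"

definition Mn :: "nat \<Rightarrow> 'a tup set" where
  "Mn n = PiE {..<n} (\<lambda>_. UNIV)"

definition tjoin :: "nat \<Rightarrow> nat \<Rightarrow> 'a tup \<Rightarrow> 'a tup \<Rightarrow> 'a tup" where
  "tjoin n m x y = (\<lambda>i. if i < n then x i else if i < n + m then y (i - n) else undefined)"

text \<open>A structure on M in the sense of van den Dries (Tame Topology, Ch. 1):
  S n is a boolean algebra of subsets of M^n, closed under cylinders, containing the
  diagonals, closed under coordinate projection. Definability with parameters is
  captured by requiring all points of M to be in S 1.\<close>

definition is_structure :: "(nat \<Rightarrow> 'a tup set set) \<Rightarrow> bool" where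
  "is_structure S \<longleftrightarrow>
     (\<forall>n. (\<forall>A\<in>S n. A \<subseteq> Mn n) \<and> Mn n \<in> S n \<and>
          (\<forall>A\<in>S n. \<forall>B\<in>S n. A \<inter> B \<in> S n \<and> Mn n - A \<in> S n)) \<and>
     (\<forall>n A. A \<in> S n \<longrightarrow>
          {tjoin n 1 x y | x y. x \<in> A \<and> y \<in> Mn 1} \<in> S (n + 1) \<and>
          {tjoin 1 n y x | x y. x \<in> A \<and> y \<in> Mn 1} \<in> S (1 + n)) \<and>
     (\<forall>n i j. i < n \<and> j < n \<longrightarrow> {x \<in> Mn n. x i = x j} \<in> S n) \<and>
     (\<forall>n A. A \<in> S (n + 1) \<longrightarrow> (\<lambda>z. restrict z {..<n}) ` A \<in> S n) \<and>
     (\<forall>c. {x \<in> Mn 1. x 0 = c} \<in> S 1)"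

definition is_open_interval :: "'a::linorder set \<Rightarrow> bool" where
  "is_open_interval I \<longleftrightarrow> (\<exists>a b. I = {a<..<b}) \<or> (\<exists>a. I = {a<..}) \<or> (\<exists>b. I = {..<b}) \<or> I = UNIV"

definition real_closed_field :: "'a::linordered_field itself \<Rightarrow> bool" where
  "real_closed_field _ \<longleftrightarrow> (\<forall>x::'a. x \<ge> 0 \<longrightarrow> (\<exists>y. y * y = x)) \<and>
     (\<forall>p::'a poly. odd (degree p) \<longrightarrow> (\<exists>x. poly p x = 0))"

definition o_minimal_expansion_rcf :: "(nat \<Rightarrow> 'a::linordered_field tup set set) \<Rightarrow> bool" where
  "o_minimal_expansion_rcf S \<longleftrightarrow>
     real_closed_field TYPE('a) \<and> is_structure S \<and>
     {x \<in> Mn 2. x 0 < x 1} \<in> S 2 \<and>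
     {x \<in> Mn 3. x 0 + x 1 = x 2} \<in> S 3 \<and>
     {x \<in> Mn 3. x 0 * x 1 = x 2} \<in> S 3 \<and>
     (\<forall>A\<in>S 1. \<exists>F. finite F \<and> (\<lambda>x. x 0) ` A = \<Union>F \<and>
                    (\<forall>I\<in>F. (\<exists>c. I = {c}) \<or> is_open_interval I))"

definition open_box :: "nat \<Rightarrow> 'a::linorder tup set \<Rightarrow> bool" where
  "open_box n U \<longleftrightarrow> U \<subseteq> Mn n \<and>
     (\<forall>x\<in>U. \<exists>a b. (\<forall>i<n. a i < x i \<and> x i < b i) \<and>
                  {y \<in> Mn n. \<forall>i<n. a i < y i \<and> y i < b i} \<subseteq> U)"

lemma istopology_open_box: "istopology (open_box (n::nat) :: 'a::linorder tup set \<Rightarrow> bool)"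
  unfolding istopology_def
proof (intro conjI allI impI)
  fix S T :: "'a tup set" assume a1: "open_box n S" and a2: "open_box n T"
  note a = a1 a2
  show "open_box n (S \<inter> T)"
    unfolding open_box_def
  proof (intro conjI ballI)
    show "S \<inter> T \<subseteq> Mn n" using a by (auto simp: open_box_def)
    fix x assume x: "x \<in> S \<inter> T"
    obtain a1 b1 where 1: "\<forall>i<n. a1 i < x i \<and> x i < b1 i" "{y \<in> Mn n. \<forall>i<n. a1 i < y i \<and> y i < b1 i} \<subseteq> S"
      using a x unfolding open_box_def by blast
    obtain a2 b2 where 2: "\<forall>i<n. a2 i < x i \<and> x i < b2 i" "{y \<in> Mn n. \<forall>i<n. a2 i < y i \<and> y i < b2 i} \<subseteq> T"
      using a x unfolding open_box_def by blast
    show "\<exists>a b. (\<forall>i<n. a i < x i \<and> x i < b i) \<and> {y \<in> Mn n. \<forall>i<n. a i < y i \<and> y i < b i} \<subseteq> S \<inter> T"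
    proof (intro exI conjI)
      show "\<forall>i<n. max (a1 i) (a2 i) < x i \<and> x i < min (b1 i) (b2 i)"
        using 1(1) 2(1) by simp
      show "{y \<in> Mn n. \<forall>i<n. max (a1 i) (a2 i) < y i \<and> y i < min (b1 i) (b2 i)} \<subseteq> S \<inter> T"
      proof
        fix y assume "y \<in> {y \<in> Mn n. \<forall>i<n. max (a1 i) (a2 i) < y i \<and> y i < min (b1 i) (b2 i)}"
        then have "y \<in> {y \<in> Mn n. \<forall>i<n. a1 i < y i \<and> y i < b1 i}"
             "y \<in> {y \<in> Mn n. \<forall>i<n. a2 i < y i \<and> y i < b2 i}" by simp_all
        then show "y \<in> S \<inter> T" using 1(2) 2(2) by blast
      qed
    qed
  qed
next
  fix K :: "'a tup set set" assume "\<forall>S\<in>K. open_box n S"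
  note K = this
  show "open_box n (\<Union>K)" unfolding open_box_def
  proof (intro conjI ballI)
    show "\<Union>K \<subseteq> Mn n" using K unfolding open_box_def by blast
    fix x assume "x \<in> \<Union>K"
    then obtain S where S: "S \<in> K" "x \<in> S" by blast
    then obtain a b where ab: "\<forall>i<n. a i < x i \<and> x i < b i" "{y \<in> Mn n. \<forall>i<n. a i < y i \<and> y i < b i} \<subseteq> S"
      using K unfolding open_box_def by blast
    show "\<exists>a b. (\<forall>i<n. a i < x i \<and> x i < b i) \<and> {y \<in> Mn n. \<forall>i<n. a i < y i \<and> y i < b i} \<subseteq> \<Union>K"
      using ab S(1) by blast
  qed
qed

definition Mtop :: "nat \<Rightarrow> 'a::linorder tup topology" where
  "Mtop n = topology (open_box n)"

lemma openin_Mtop: "openin (Mtop n) U \<longleftrightarrow> open_box n U"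
  unfolding Mtop_def by (simp add: istopology_open_box)

definition def_map :: "(nat \<Rightarrow> 'a tup set set) \<Rightarrow> nat \<Rightarrow> nat \<Rightarrow> 'a tup set \<Rightarrow> ('a tup \<Rightarrow> 'a tup) \<Rightarrow> bool" where
  "def_map S k n X f \<longleftrightarrow> X \<in> S k \<and> f ` X \<subseteq> Mn n \<and> {tjoin k n x (f x) | x. x \<in> X} \<in> S (k + n)"

definition def_manifold :: "(nat \<Rightarrow> 'a::linorder tup set set) \<Rightarrow> nat \<Rightarrow> nat \<Rightarrow> 'a tup set \<Rightarrow> 'a tup topology \<Rightarrow> bool" where
  "def_manifold S k n X T \<longleftrightarrow> X \<in> S k \<and> topspace T = X \<and>
     (\<exists>F \<phi>. finite F \<and> \<Union>F = X \<and>
        (\<forall>U\<in>F. U \<in> S k \<and> openin T U \<and> def_map S k n U (\<phi> U) \<and>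
                 openin (Mtop n) (\<phi> U ` U) \<and>
                 homeomorphic_map (subtopology T U) (subtopology (Mtop n) (\<phi> U ` U)) (\<phi> U)))"

definition def_group :: "(nat \<Rightarrow> 'a tup set set) \<Rightarrow> nat \<Rightarrow> 'a tup monoid \<Rightarrow> bool" where
  "def_group S k G \<longleftrightarrow> group G \<and> carrier G \<in> S k \<and>
     {tjoin (k + k) k (tjoin k k x y) (x \<otimes>\<^bsub>G\<^esub> y) | x y. x \<in> carrier G \<and> y \<in> carrier G} \<in> S (k + k + k)"

definition is_topgroup :: "'b topology \<Rightarrow> ('b \<Rightarrow> 'b \<Rightarrow> 'b) \<Rightarrow> ('b \<Rightarrow> 'b) \<Rightarrow> bool" where
  "is_topgroup T m i \<longleftrightarrow> continuous_map (prod_topology T T) T (\<lambda>(x, y). m x y) \<and> continuous_map T T i"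

text \<open>The definable manifold topology of a definable group (unique by Pillay).\<close>

definition def_group_topology :: "(nat \<Rightarrow> 'a::linorder tup set set) \<Rightarrow> nat \<Rightarrow> 'a tup monoid \<Rightarrow> 'a tup topology \<Rightarrow> bool" where
  "def_group_topology S k G T \<longleftrightarrow> def_group S k G \<and> (\<exists>n. def_manifold S k n (carrier G) T) \<and>
     is_topgroup T (\<lambda>x y. x \<otimes>\<^bsub>G\<^esub> y) (\<lambda>x. inv\<^bsub>G\<^esub> x)"

definition quot_top :: "'b topology \<Rightarrow> ('b \<Rightarrow> 'c) \<Rightarrow> 'c topology" where
  "quot_top T q = topology (\<lambda>U. U \<subseteq> q ` topspace T \<and> openin T {x \<in> topspace T. q x \<in> U})"

lemma openin_quot_top:
  "openin (quot_top T q) U \<longleftrightarrow> U \<subseteq> q ` topspace T \<and> openin T {x \<in> topspace T. q x \<in> U}"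
proof -
  have "istopology (\<lambda>U. U \<subseteq> q ` topspace T \<and> openin T {x \<in> topspace T. q x \<in> U})"
    unfolding istopology_def
  proof (rule conjI; intro allI impI)
    fix S U assume a: "S \<subseteq> q ` topspace T \<and> openin T {x \<in> topspace T. q x \<in> S}"
       "U \<subseteq> q ` topspace T \<and> openin T {x \<in> topspace T. q x \<in> U}"
    have eq: "{x \<in> topspace T. q x \<in> S \<inter> U} = {x \<in> topspace T. q x \<in> S} \<inter> {x \<in> topspace T. q x \<in> U}" by auto
    have o: "openin T ({x \<in> topspace T. q x \<in> S} \<inter> {x \<in> topspace T. q x \<in> U})"
      using a by (intro openin_Int) simp_all
    have s: "S \<inter> U \<subseteq> q ` topspace T" using a by blast
    show "S \<inter> U \<subseteq> q ` topspace T \<and> openin T {x \<in> topspace T. q x \<in> S \<inter> U}"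
      using o s by (simp only: eq)
  next
    fix K assume a: "\<forall>S\<in>K. S \<subseteq> q ` topspace T \<and> openin T {x \<in> topspace T. q x \<in> S}"
    have "{x \<in> topspace T. q x \<in> \<Union>K} = (\<Union>S\<in>K. {x \<in> topspace T. q x \<in> S})" by auto
    then show "\<Union>K \<subseteq> q ` topspace T \<and> openin T {x \<in> topspace T. q x \<in> \<Union>K}" using a by auto
  qed
  then show ?thesis unfolding quot_top_def by simp
qed

text \<open>The quotient group G/H realised on \<iota> ` carrier G.\<close>

definition quot_group :: "'a monoid \<Rightarrow> ('a \<Rightarrow> 'b) \<Rightarrow> 'b monoid" where
  "quot_group G \<iota> = \<lparr>carrier = \<iota> ` carrier G,
     mult = (\<lambda>y z. \<iota> (inv_into (carrier G) \<iota> y \<otimes>\<^bsub>G\<^esub> inv_into (carrier G) \<iota> z)),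
     one = \<iota> \<one>\<^bsub>G\<^esub>\<rparr>"

end

theory Submission
  imports Defs
begin

text \<open>Everything rests on one fact: a definable map between definable manifolds is continuous at
  some point. Applied to a definable section \<open>s\<close> of \<open>\<iota>\<close> it yields a point \<open>g\<close> such that \<open>\<iota>\<close> sends
  every neighbourhood of \<open>g\<close> to a \<open>\<tau>\<close>-neighbourhood of \<open>\<iota> g\<close>, because the image contains the
  preimage of that neighbourhood under \<open>s\<close>. By homogeneity \<open>\<iota>\<close> is open, and it is continuous as
  an orbit map of the action. Applied to \<open>\<iota>\<close> itself, for normal \<open>H\<close>, the fact makes \<open>\<iota>\<close>
  continuous into the group \<open>G/H\<close>, so that \<open>G\<close> acts continuously on \<open>G/H\<close> and the first part
  applies.

  Neither dimension theory nor cell decomposition is needed for the point of continuity. It comes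
  from a uniformity principle: if \<open>R x c\<close> is definable, inherited by smaller \<open>c > 0\<close>, and true for
  some \<open>c > 0\<close> at each \<open>x\<close> of a box, then a single \<open>c\<close> works on a whole subbox.\<close>

section \<open>Definability by first-order formulas\<close>

text \<open>The field \<open>M\<close> may be neither complete nor archimedean, and its closed boxes
  need not be compact, so no category or compactness argument yields a point of continuity. Infima
  are available only for definable sets, and a constant found pointwise becomes uniform only through
  o-minimality. Hence every auxiliary set must be shown definable, and closure rules are stated for
  predicates rather than sets: a set is then definable because of the formula that describes it. The
  uniformity principle plays the part of a Baire argument. In one variable it rests on monotonicity
  in \<open>c\<close>. In several variables the obstacle is that the interval found on the line
  above a point depends on that point, so that both its starting point and its length have to be
  made independent of it. Sections exist because an element of a nonempty definable subset of
  \<open>M\<close> can be singled out by an explicit formula in infima and midpoints.\<close>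

locale def_structure =
  fixes S :: "nat \<Rightarrow> 'a tup set set"
  assumes struct: "is_structure S"
begin

lemma S_sub: "A \<in> S n \<Longrightarrow> A \<subseteq> Mn n"
  and S_univ: "Mn n \<in> S n"
  and S_Int: "A \<in> S n \<Longrightarrow> B \<in> S n \<Longrightarrow> A \<inter> B \<in> S n"
  and S_compl: "A \<in> S n \<Longrightarrow> Mn n - A \<in> S n"
  and S_diag: "i < n \<Longrightarrow> j < n \<Longrightarrow> {x \<in> Mn n. x i = x j} \<in> S n"
  and S_proj: "B \<in> S (Suc n) \<Longrightarrow> (\<lambda>z. restrict z {..<n}) ` B \<in> S n"
  and S_point: "{x \<in> Mn 1. x 0 = c} \<in> S 1"
  using struct unfolding is_structure_def by auto

lemma S_cyl_right:
  assumes "A \<in> S n"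
  shows "{z \<in> Mn (Suc n). restrict z {..<n} \<in> A} \<in> S (Suc n)"
proof -
  have "{z \<in> Mn (Suc n). restrict z {..<n} \<in> A} = {tjoin n 1 x y | x y. x \<in> A \<and> y \<in> Mn 1}"
    (is "?L = ?R")
  proof (intro Set.set_eqI iffI)
    fix z assume z: "z \<in> ?L"
    then have "z = tjoin n 1 (restrict z {..<n}) (restrict (\<lambda>i. z n) {..<1})"
      by (auto simp: tjoin_def Mn_def PiE_iff extensional_def fun_eq_iff less_Suc_eq)
    with z show "z \<in> ?R" by (intro CollectI exI conjI) (auto simp: Mn_def)
  next
    fix z assume "z \<in> ?R"
    then obtain x y where xy: "z = tjoin n 1 x y" "x \<in> A" "y \<in> Mn 1" by auto
    then have "restrict z {..<n} = x"
      using S_sub[OF assms] by (auto simp: tjoin_def Mn_def PiE_iff extensional_def fun_eq_iff)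
    with xy show "z \<in> ?L" by (auto simp: tjoin_def Mn_def PiE_iff extensional_def)
  qed
  then show ?thesis using struct assms unfolding is_structure_def by auto
qed

lemma S_cyl_left1:
  assumes "A \<in> S n"
  shows "{z \<in> Mn (Suc n). restrict (\<lambda>i. z (Suc i)) {..<n} \<in> A} \<in> S (Suc n)"
proof -
  have "{z \<in> Mn (Suc n). restrict (\<lambda>i. z (Suc i)) {..<n} \<in> A}
      = {tjoin 1 n y x | x y. x \<in> A \<and> y \<in> Mn 1}"
    (is "?L = ?R")
  proof (intro Set.set_eqI iffI)
    fix z assume z: "z \<in> ?L"
    then have "z = tjoin 1 n (restrict z {..<1}) (restrict (\<lambda>i. z (Suc i)) {..<n})"
      by (auto simp: tjoin_def Mn_def PiE_iff extensional_def fun_eq_iff)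
    with z show "z \<in> ?R" by (intro CollectI exI conjI) (auto simp: Mn_def)
  next
    fix z assume "z \<in> ?R"
    then obtain x y where xy: "z = tjoin 1 n y x" "x \<in> A" "y \<in> Mn 1" by auto
    then have "restrict (\<lambda>i. z (Suc i)) {..<n} = x"
      using S_sub[OF assms] by (auto simp: tjoin_def Mn_def PiE_iff extensional_def fun_eq_iff)
    with xy show "z \<in> ?L" by (auto simp: tjoin_def Mn_def PiE_iff extensional_def)
  qed
  then show ?thesis using struct assms unfolding is_structure_def by auto
qed

lemma S_cyl_left:
  assumes "A \<in> S n"
  shows "{z \<in> Mn (m + n). restrict (\<lambda>i. z (m + i)) {..<n} \<in> A} \<in> S (m + n)"
proof (induction m)
  case 0
  have "{z \<in> Mn n. restrict z {..<n} \<in> A} = A"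
    using S_sub[OF assms] by (auto simp: Mn_def PiE_restrict)
  with assms show ?case by (simp only: add_0)
next
  case (Suc m)
  have *: "{z \<in> Mn (Suc (m + n)). restrict (\<lambda>i. z (Suc i)) {..<m+n}
            \<in> {z \<in> Mn (m + n). restrict (\<lambda>i. z (m + i)) {..<n} \<in> A}}
      = {z \<in> Mn (Suc m + n). restrict (\<lambda>i. z (Suc m + i)) {..<n} \<in> A}"
    by (auto simp: Mn_def PiE_iff cong: restrict_cong)
  show ?case using S_cyl_left1[OF Suc] unfolding * add_Suc .
qed

lemma S_proj_many:
  assumes "A \<in> S (m + n)"
  shows "(\<lambda>z. restrict z {..<m}) ` A \<in> S m"
  using assms
proof (induction n arbitrary: A)
  case 0
  have "restrict z {..<m} = z" if "z \<in> A" for z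
    using that S_sub[OF 0] by (auto simp: Mn_def PiE_restrict)
  then show ?case using 0 by simp
next
  case (Suc n)
  have "(\<lambda>z. restrict z {..<m}) ` A = (\<lambda>z. restrict z {..<m}) ` (\<lambda>z. restrict z {..<m+n}) ` A"
    unfolding image_image by (intro image_cong refl) (auto simp: fun_eq_iff restrict_def)
  moreover have "(\<lambda>z. restrict z {..<m+n}) ` A \<in> S (m + n)"
    using Suc.prems S_proj by simp
  ultimately show ?case using Suc.IH by (simp only:)
qed

text \<open>Formulas are predicates on environments \<open>nat \<Rightarrow> 'a\<close> depending on finitely many
  variables; quantification follows the de Bruijn convention.\<close>

definition supp_def :: "nat \<Rightarrow> ('a tup \<Rightarrow> bool) \<Rightarrow> bool" where
  "supp_def N P \<longleftrightarrow> (\<forall>e e'. (\<forall>i<N. e i = e' i) \<longrightarrow> P e = P e') \<and> {x \<in> Mn N. P x} \<in> S N"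

definition dpred :: "('a tup \<Rightarrow> bool) \<Rightarrow> bool" where
  "dpred P \<longleftrightarrow> (\<exists>N. supp_def N P)"

text \<open>A function is identified with its graph: the value occupies variable 0 and the arguments
  are shifted by one. Closure rules for terms thereby reduce to rules for predicates.\<close>

definition dterm :: "('a tup \<Rightarrow> 'a) \<Rightarrow> bool" where
  "dterm t \<longleftrightarrow> dpred (\<lambda>e. e 0 = t (\<lambda>i. e (Suc i)))"

named_theorems def_intros

lemma supp_defD: "supp_def N P \<Longrightarrow> {x \<in> Mn N. P x} \<in> S N"
  unfolding supp_def_def by (rule conjunct2)

lemma supp_def_cong: "supp_def N P \<Longrightarrow> (\<And>i. i < N \<Longrightarrow> e i = e' i) \<Longrightarrow> P e = P e'"
  unfolding supp_def_def by blast

lemma supp_def_Suc: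
  assumes "supp_def N P" shows "supp_def (Suc N) P"
proof -
  have "P (restrict z {..<N}) = P z" for z
    by (intro supp_def_cong[OF assms]) auto
  then have "{z \<in> Mn (Suc N). restrict z {..<N} \<in> {x \<in> Mn N. P x}} = {x \<in> Mn (Suc N). P x}"
    by (auto simp: Mn_def)
  then have "{x \<in> Mn (Suc N). P x} \<in> S (Suc N)"
    using S_cyl_right[OF supp_defD[OF assms]] by simp
  moreover have "P e = P e'" if "\<forall>i<Suc N. e i = e' i" for e e'
    using that by (intro supp_def_cong[OF assms]) auto
  ultimately show ?thesis
    unfolding supp_def_def by blast
qed

lemma supp_def_mono:
  assumes "supp_def N P" "N \<le> N'" shows "supp_def N' P"
  using assms(2,1) by (induction rule: dec_induct) (auto intro: supp_def_Suc)

lemma dpred_not [def_intros]: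
  assumes "dpred P" shows "dpred (\<lambda>e. \<not> P e)"
proof -
  obtain N where N: "supp_def N P" using assms dpred_def by auto
  have "{x \<in> Mn N. \<not> P x} = Mn N - {x \<in> Mn N. P x}" by auto
  then have "{x \<in> Mn N. \<not> P x} \<in> S N" using S_compl[OF supp_defD[OF N]] by simp
  then have "supp_def N (\<lambda>e. \<not> P e)"
    using supp_def_cong[OF N] unfolding supp_def_def by blast
  then show ?thesis using dpred_def by auto
qed

lemma dpred_conj [def_intros]:
  assumes "dpred P" "dpred Q" shows "dpred (\<lambda>e. P e \<and> Q e)"
proof -
  obtain N N' where "supp_def N P" "supp_def N' Q" using assms dpred_def by auto
  then have N: "supp_def (max N N') P" "supp_def (max N N') Q"
    using supp_def_mono by (meson max.cobounded1 max.cobounded2)+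
  have "{x \<in> Mn (max N N'). P x \<and> Q x} = {x \<in> Mn (max N N'). P x} \<inter> {x \<in> Mn (max N N'). Q x}"
    by auto
  then have "{x \<in> Mn (max N N'). P x \<and> Q x} \<in> S (max N N')"
    using S_Int[OF N[THEN supp_defD]] by simp
  then have "supp_def (max N N') (\<lambda>e. P e \<and> Q e)"
    using N[THEN supp_def_cong] unfolding supp_def_def by blast
  then show ?thesis using dpred_def by auto
qed

lemma dpred_disj [def_intros]:
  assumes "dpred P" "dpred Q" shows "dpred (\<lambda>e. P e \<or> Q e)"
  using dpred_not[OF dpred_conj[OF dpred_not[OF assms(1)] dpred_not[OF assms(2)]]] by simp

lemma dpred_imp [def_intros]:
  assumes "dpred P" "dpred Q" shows "dpred (\<lambda>e. P e \<longrightarrow> Q e)"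
  unfolding imp_conv_disj by (intro dpred_disj dpred_not assms)

lemma dpred_bool [def_intros]: "dpred (\<lambda>e. b)"
proof -
  have "{x \<in> Mn 0. b} \<in> S 0" using S_univ[of 0] S_compl[OF S_univ[of 0]] by (cases b) auto
  then have "supp_def 0 (\<lambda>e. b)" unfolding supp_def_def by auto
  then show ?thesis using dpred_def by auto
qed

lemma dpred_all_less [def_intros]:
  assumes "\<And>i. i < n \<Longrightarrow> dpred (P i)" shows "dpred (\<lambda>e. \<forall>i<(n::nat). P i e)"
  using assms
proof (induction n)
  case 0 then show ?case using dpred_bool[of True] by simp
next
  case (Suc n)
  then have "dpred (\<lambda>e. (\<forall>i<n. P i e) \<and> P n e)" by (intro dpred_conj) auto
  then show ?case by (simp add: All_less_Suc conj_commute)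
qed

lemma supp_def_var_eq: "i < n \<Longrightarrow> j < n \<Longrightarrow> supp_def n (\<lambda>e. e i = e j)"
  unfolding supp_def_def using S_diag[of i n j] by auto

text \<open>The axioms of a structure neither permute nor identify coordinates directly. A copy of
  the N arguments is adjoined behind the M variables, tied to them by the diagonals
  \<open>z (M + i) = z (\<sigma> i)\<close>, and projected away.\<close>

lemma supp_def_rename:
  assumes P: "supp_def N P" and \<sigma>: "\<And>i. i < N \<Longrightarrow> \<sigma> i < M"
  shows "supp_def M (\<lambda>e. P (\<lambda>i. e (\<sigma> i)))"
proof -
  define A where "A = {x \<in> Mn N. P x}"
  define B where "B n = {z \<in> Mn (M + N). restrict (\<lambda>i. z (M + i)) {..<N} \<in> A
      \<and> (\<forall>i<n. z (M + i) = z (\<sigma> i))}" for n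
  have A: "A \<in> S N" using supp_defD[OF P] unfolding A_def .
  have "B n \<in> S (M + N)" if "n \<le> N" for n using that
  proof (induction n)
    case 0 then show ?case using S_cyl_left[OF A, of M] unfolding B_def by simp
  next
    case (Suc n)
    then have "\<sigma> n < M + N" using \<sigma>[of n] by simp
    then have "{z \<in> Mn (M + N). z (M + n) = z (\<sigma> n)} \<in> S (M + N)" using Suc by (intro S_diag) auto
    moreover have "B (Suc n) = B n \<inter> {z \<in> Mn (M + N). z (M + n) = z (\<sigma> n)}"
      unfolding B_def by (auto simp: less_Suc_eq)
    ultimately show ?case using Suc S_Int by simp
  qed
  then have "(\<lambda>z. restrict z {..<M}) ` B N \<in> S M" by (intro S_proj_many[where n = N]) simp
  moreover have "(\<lambda>z. restrict z {..<M}) ` B N = {x \<in> Mn M. P (\<lambda>i. x (\<sigma> i))}" (is "?L = ?R")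
  proof (intro Set.set_eqI iffI)
    fix x assume "x \<in> ?L"
    then obtain z where z: "z \<in> B N" "x = restrict z {..<M}" by auto
    then have "P (restrict (\<lambda>i. z (M + i)) {..<N})" unfolding B_def A_def by auto
    also have "P (restrict (\<lambda>i. z (M + i)) {..<N}) = P (\<lambda>i. x (\<sigma> i))"
      using z \<sigma> by (intro supp_def_cong[OF P]) (auto simp: B_def)
    finally show "x \<in> ?R" using z by (auto simp: Mn_def)
  next
    fix x assume x: "x \<in> ?R"
    define z where "z = (\<lambda>i. if i < M then x i else if i < M + N then x (\<sigma> (i - M)) else undefined)"
    have "restrict (\<lambda>i. z (M + i)) {..<N} \<in> A"
      using x unfolding A_def z_def
      by (auto simp: Mn_def PiE_iff elim!: supp_def_cong[OF P, THEN iffD1, rotated])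
    then have "z \<in> B N" using \<sigma> unfolding B_def by (auto simp: z_def Mn_def PiE_iff extensional_def)
    moreover have "x = restrict z {..<M}"
      using x by (auto simp: z_def Mn_def PiE_iff extensional_def fun_eq_iff)
    ultimately show "x \<in> ?L" by auto
  qed
  moreover have "P (\<lambda>i. e (\<sigma> i)) = P (\<lambda>i. e' (\<sigma> i))" if "\<forall>i<M. e i = e' i" for e e'
    using that \<sigma> by (intro supp_def_cong[OF P]) auto
  ultimately show ?thesis unfolding supp_def_def by (simp only:) blast
qed

lemma dpred_rename:
  assumes "dpred P" shows "dpred (\<lambda>e. P (\<lambda>i. e (\<sigma> i)))"
proof -
  obtain N where N: "supp_def N P" using assms dpred_def by auto
  have "\<sigma> i < Suc (Max (\<sigma> ` {..<N}))" if "i < N" for i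
    using that by (simp add: less_Suc_eq_le)
  from supp_def_rename[where \<sigma> = \<sigma>, OF N this] show ?thesis unfolding dpred_def by blast
qed

text \<open>The projection axiom forgets the last coordinate, whereas the bound variable sits at 0.
  A renaming moves it to position N, behind the free variables.\<close>

lemma dpred_ex [def_intros]:
  assumes "dpred (\<lambda>e. P (e 0) (\<lambda>i. e (Suc i)))"
  shows "dpred (\<lambda>e. \<exists>y. P y e)"
proof -
  obtain N where N: "supp_def N (\<lambda>e. P (e 0) (\<lambda>i. e (Suc i)))" using assms dpred_def by auto
  have dep: "P y e = P y e'" if "\<And>i. i < N \<Longrightarrow> e i = e' i" for y e e'
    using supp_def_cong[OF N, of "case_nat y e" "case_nat y e'"] that
    by (auto split: nat.splits)
  have "supp_def (Suc N) (\<lambda>e. P (e (case 0 of 0 \<Rightarrow> N | Suc i \<Rightarrow> i)) (\<lambda>i. e (case Suc i of 0 \<Rightarrow> N | Suc i \<Rightarrow> i)))"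
    by (rule supp_def_rename[OF N, where \<sigma> = "\<lambda>i. case i of 0 \<Rightarrow> N | Suc i \<Rightarrow> i"])
       (auto split: nat.splits)
  from supp_defD[OF this] have "{z \<in> Mn (Suc N). P (z N) z} \<in> S (Suc N)" by simp
  then have "(\<lambda>z. restrict z {..<N}) ` {z \<in> Mn (Suc N). P (z N) z} \<in> S N" by (rule S_proj)
  moreover have "(\<lambda>z. restrict z {..<N}) ` {z \<in> Mn (Suc N). P (z N) z} = {x \<in> Mn N. \<exists>y. P y x}"
    (is "?L = ?R")
  proof (intro Set.set_eqI iffI)
    fix x assume "x \<in> ?L"
    then obtain z where "z \<in> Mn (Suc N)" "P (z N) z" "x = restrict z {..<N}" by auto
    moreover from this have "P (z N) x" using dep[of z x "z N"] by auto
    ultimately show "x \<in> ?R" by (auto simp: Mn_def)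
  next
    fix x assume "x \<in> ?R"
    then obtain y where xy: "x \<in> Mn N" "P y x" by auto
    then have "P y (x(N := y))" using dep[of x "x(N := y)" y] by auto
    moreover have "x(N := y) \<in> Mn (Suc N)" "x = restrict (x(N := y)) {..<N}"
      using xy by (auto simp: Mn_def PiE_iff extensional_def fun_eq_iff)
    ultimately show "x \<in> ?L" by (intro image_eqI[of _ _ "x(N := y)"]) auto
  qed
  ultimately have "{x \<in> Mn N. \<exists>y. P y x} \<in> S N" by (simp only:)
  moreover have "(\<exists>y. P y e) = (\<exists>y. P y e')" if "\<forall>i<N. e i = e' i" for e e'
    using dep[of e e'] that by simp
  ultimately have "supp_def N (\<lambda>e. \<exists>y. P y e)" unfolding supp_def_def by blast
  then show ?thesis using dpred_def by auto
qed

lemma dpred_all [def_intros]: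
  assumes "dpred (\<lambda>e. P (e 0) (\<lambda>i. e (Suc i)))"
  shows "dpred (\<lambda>e. \<forall>y. P y e)"
  using dpred_not[OF dpred_ex[of "\<lambda>y e. \<not> P y e"]] dpred_not[OF assms] by simp

lemma Mn_Suc_iff: "(\<exists>y\<in>Mn (Suc n). Q y) \<longleftrightarrow> (\<exists>y\<in>Mn n. \<exists>v. Q (y(n := v)))"
proof
  assume "\<exists>y\<in>Mn (Suc n). Q y"
  then obtain y where y: "y \<in> Mn (Suc n)" "Q y" by auto
  then have "(restrict y {..<n})(n := y n) = y" "restrict y {..<n} \<in> Mn n"
    by (auto simp: Mn_def PiE_iff extensional_def fun_eq_iff)
  then show "\<exists>y\<in>Mn n. \<exists>v. Q (y(n := v))" using y by metis
next
  assume "\<exists>y\<in>Mn n. \<exists>v. Q (y(n := v))"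
  then obtain y v where "y \<in> Mn n" "Q (y(n := v))" by auto
  moreover from this have "y(n := v) \<in> Mn (Suc n)" by (auto simp: Mn_def PiE_iff extensional_def)
  ultimately show "\<exists>y\<in>Mn (Suc n). Q y" by auto
qed

text \<open>The bound tuple occupies variables 0 to n - 1 and the environment is shifted by n. The
  induction splits off the last coordinate as the innermost quantifier.\<close>

lemma dpred_ex_tup [def_intros]:
  assumes "dpred (\<lambda>e. P (restrict e {..<n}) (\<lambda>i. e (i + n)))"
  shows "dpred (\<lambda>e. \<exists>y\<in>Mn n. P y e)"
  using assms
proof (induction n arbitrary: P)
  case 0
  then show ?case by (simp add: Mn_def PiE_empty_domain)
next
  case (Suc n)
  \<comment> \<open>Brings coordinate n of the tuple to variable 0, where the innermost quantifier
    expects it; the coordinates before it move up by one.\<close>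
  let ?\<sigma> = "\<lambda>i. if i < n then Suc i else if i = n then 0 else i"
  have "dpred (\<lambda>e. P ((restrict (\<lambda>i. e (Suc i)) {..<n})(n := e 0)) (\<lambda>i. e (Suc (i + n))))"
    by (rule back_subst[of dpred, OF dpred_rename[OF Suc.prems, of ?\<sigma>]])
       (intro ext arg_cong2[of _ _ _ _ P], auto simp: restrict_def)
  then have "dpred (\<lambda>e. \<exists>v. P ((restrict e {..<n})(n := v)) (\<lambda>i. e (i + n)))"
    by (intro dpred_ex)
  then have "dpred (\<lambda>e. \<exists>y\<in>Mn n. \<exists>v. P (y(n := v)) e)"
    by (rule Suc.IH)
  then show ?case unfolding Mn_Suc_iff .
qed

lemma dpred_all_tup [def_intros]:
  assumes "dpred (\<lambda>e. P (restrict e {..<n}) (\<lambda>i. e (i + n)))"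
  shows "dpred (\<lambda>e. \<forall>y\<in>Mn n. P y e)"
  using dpred_not[OF dpred_ex_tup[of "\<lambda>y e. \<not> P y e"]] dpred_not[OF assms] by simp

lemma dpred_var_eq: "dpred (\<lambda>e. e i = e j)"
  unfolding dpred_def by (rule exI[of _ "Suc (max i j)"], rule supp_def_var_eq) auto

text \<open>P sees only finitely many variables, so the values substituted for them can be named by
  a quantified tuple and tied to the terms through their graphs.\<close>

lemma dpred_subst:
  assumes "dpred P" and T: "\<And>i. dterm (\<lambda>e. T e i)"
  shows "dpred (\<lambda>e. P (T e))"
proof -
  obtain N where N: "supp_def N P" using assms dpred_def by auto
  have *: "P (T e) \<longleftrightarrow> (\<exists>y\<in>Mn N. (\<forall>i<N. y i = T e i) \<and> P y)" for e
  proof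
    assume "P (T e)"
    then show "\<exists>y\<in>Mn N. (\<forall>i<N. y i = T e i) \<and> P y"
      using supp_def_cong[OF N, of "T e" "restrict (T e) {..<N}"]
      by (intro bexI[of _ "restrict (T e) {..<N}"]) (auto simp: Mn_def)
  next
    assume "\<exists>y\<in>Mn N. (\<forall>i<N. y i = T e i) \<and> P y"
    then obtain y where "\<forall>i<N. y i = T e i" "P y" by auto
    then show "P (T e)" using supp_def_cong[OF N, of y "T e"] by simp
  qed
  show ?thesis unfolding *
  proof (rule dpred_ex_tup)
    show "dpred (\<lambda>e. (\<forall>i<N. restrict e {..<N} i = T (\<lambda>i. e (i + N)) i) \<and> P (restrict e {..<N}))"
    proof (intro dpred_conj dpred_all_less)
      show "dpred (\<lambda>e. restrict e {..<N} i = T (\<lambda>i. e (i + N)) i)" if "i < N" for i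
        using that dpred_rename[OF T[of i, unfolded dterm_def], of "case_nat i (\<lambda>j. j + N)"] by simp
      have "P (restrict e {..<N}) = P e" for e by (rule supp_def_cong[OF N]) auto
      then show "dpred (\<lambda>e. P (restrict e {..<N}))" using assms by simp
    qed
  qed
qed

lemma dterm_var [def_intros]: "dterm (\<lambda>e. e i)"
  unfolding dterm_def by (rule dpred_var_eq)

lemma dterm_const [def_intros]: "dterm (\<lambda>e. c)"
proof -
  have "supp_def 1 (\<lambda>e. e 0 = c)" unfolding supp_def_def using S_point[of c] by auto
  then show ?thesis unfolding dterm_def dpred_def by auto
qed

lemma dterm_rename: "dterm t \<Longrightarrow> dterm (\<lambda>e. t (\<lambda>i. e (\<sigma> i)))"
  unfolding dterm_def
  using dpred_rename[of "\<lambda>e. e 0 = t (\<lambda>i. e (Suc i))" "case_nat 0 (\<lambda>i. Suc (\<sigma> i))"] by simp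

lemma dterm_subst:
  assumes t: "dterm t" and T: "\<And>i. dterm (\<lambda>e. T e i)"
  shows "dterm (\<lambda>e. t (T e))"
proof -
  have "dterm (\<lambda>e. (case_nat (e 0) (T (\<lambda>i. e (Suc i)))) j)" for j
    using dterm_rename[OF T, of Suc] by (cases j) (auto intro: dterm_var)
  from dpred_subst[OF t[unfolded dterm_def], where T = "\<lambda>e. case_nat (e 0) (T (\<lambda>i. e (Suc i)))", OF this] show ?thesis unfolding dterm_def by simp
qed

lemma dpred_binary:
  assumes "dpred (\<lambda>e. R (e 0) (e 1))" "dterm s" "dterm t"
  shows "dpred (\<lambda>e. R (s e) (t e))"
proof -
  have "dterm (\<lambda>e. if i = 0 then s e else t e)" for i :: nat
    using assms by (cases "i = 0") auto
  from dpred_subst[OF assms(1), where T = "\<lambda>e i. if i = 0 then s e else t e", OF this]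
  show ?thesis by simp
qed

lemma dterm_binary:
  assumes "dterm (\<lambda>e. f (e 0) (e 1))" "dterm s" "dterm t"
  shows "dterm (\<lambda>e. f (s e) (t e))"
proof -
  have "dterm (\<lambda>e. if i = 0 then s e else t e)" for i :: nat
    using assms by (cases "i = 0") auto
  from dterm_subst[OF assms(1), where T = "\<lambda>e i. if i = 0 then s e else t e", OF this]
  show ?thesis by simp
qed

lemma dpred_eq [def_intros]: "dterm s \<Longrightarrow> dterm t \<Longrightarrow> dpred (\<lambda>e. s e = t e)"
  by (rule dpred_binary[where R = "(=)"]) (rule dpred_var_eq)

lemma dterm_if [def_intros]:
  assumes "dpred P" "dterm s" "dterm t"
  shows "dterm (\<lambda>e. if P e then s e else t e)"
proof -
  have "dpred (\<lambda>e. (P (\<lambda>i. e (Suc i)) \<and> e 0 = s (\<lambda>i. e (Suc i)))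
     \<or> (\<not> P (\<lambda>i. e (Suc i)) \<and> e 0 = t (\<lambda>i. e (Suc i))))"
    using dpred_rename[OF assms(1), of Suc] dterm_rename[OF assms(2), of Suc]
      dterm_rename[OF assms(3), of Suc]
    by (intro def_intros)
  then show ?thesis unfolding dterm_def by (rule back_subst[of dpred]) auto
qed

lemma dterm_upd [def_intros]:
  assumes "dterm (\<lambda>e. X e i)" "dterm t"
  shows "dterm (\<lambda>e. ((X e)(n := t e)) i)"
  using assms by (cases "i = n") auto

lemma dterm_restrict [def_intros]:
  assumes "dterm (\<lambda>e. X e i)"
  shows "dterm (\<lambda>e. restrict (X e) A i)"
  using assms dterm_const[of undefined] by (cases "i \<in> A") auto

text \<open>Definability of a relation is proved once, at plain variables, and transferred here to
  arbitrary terms. The local \<open>def_intros\<close> rules for auxiliary predicates are obtained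
  in this way.\<close>

lemma dpred_app:
  assumes "dpred (\<lambda>e. R (\<lambda>i. e (Suc i)) (e 0))" "\<And>i. dterm (\<lambda>e. X e i)" "dterm t"
  shows "dpred (\<lambda>e. R (X e) (t e))"
proof -
  have "dterm (\<lambda>e. (case_nat (t e) (X e)) j)" for j
    using assms by (cases j) auto
  from dpred_subst[OF assms(1), where T = "\<lambda>e. case_nat (t e) (X e)", OF this] show ?thesis by simp
qed

text \<open>Membership in \<open>Mn n\<close> pins the coordinates from n on to
  \<open>undefined\<close>, so these are constant terms.\<close>

lemma dpred_mem:
  assumes A: "A \<in> S n" and "\<And>i. i < n \<Longrightarrow> dterm (\<lambda>e. T e i)" "\<And>e. T e \<in> Mn n"
  shows "dpred (\<lambda>e. T e \<in> A)"
proof -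
  have "{x \<in> Mn n. restrict x {..<n} \<in> A} = A"
    using S_sub[OF A] by (auto simp: Mn_def PiE_restrict)
  moreover have "restrict e {..<n} = restrict e' {..<n}" if "\<forall>i<n. e i = e' i" for e e' :: "'a tup"
    using that by auto
  ultimately have "supp_def n (\<lambda>e. restrict e {..<n} \<in> A)"
    unfolding supp_def_def using A by (metis (no_types, lifting))
  then have "dpred (\<lambda>e. restrict e {..<n} \<in> A)" using dpred_def by auto
  moreover have "dterm (\<lambda>e. T e i)" for i
  proof (cases "i < n")
    case False
    then have "(\<lambda>e. T e i) = (\<lambda>e. undefined)" using assms(3) by (auto simp: Mn_def PiE_iff extensional_def)
    then show ?thesis using dterm_const by simp
  qed (use assms in auto)
  ultimately have "dpred (\<lambda>e. restrict (T e) {..<n} \<in> A)" by (rule dpred_subst)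
  moreover have "restrict (T e) {..<n} = T e" for e
    using PiE_restrict[OF assms(3)[unfolded Mn_def]] .
  ultimately show ?thesis by (simp only:)
qed

text \<open>P may mention variables beyond n; on \<open>Mn n\<close> they have the fixed value
  \<open>undefined\<close>. Restricting the environment freezes them at this value, after which the
  surplus coordinates are projected away.\<close>

lemma dpred_imp_S:
  assumes "dpred P" "\<And>x. x \<in> A \<longleftrightarrow> x \<in> Mn n \<and> P x"
  shows "A \<in> S n"
proof -
  have "dpred (\<lambda>e. P (restrict e {..<n}))"
    using assms(1) by (rule dpred_subst) (intro def_intros)
  then obtain N where N: "supp_def N (\<lambda>e. P (restrict e {..<n}))" using dpred_def by auto
  then have "supp_def (n + N) (\<lambda>e. P (restrict e {..<n}))" by (rule supp_def_mono) simp
  then have "{x \<in> Mn (n + N). P (restrict x {..<n})} \<in> S (n + N)" by (rule supp_defD)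
  then have "(\<lambda>z. restrict z {..<n}) ` {x \<in> Mn (n + N). P (restrict x {..<n})} \<in> S n"
    by (rule S_proj_many)
  moreover have "(\<lambda>z. restrict z {..<n}) ` {x \<in> Mn (n + N). P (restrict x {..<n})} = A"
  proof (intro Set.set_eqI iffI)
    fix x assume "x \<in> (\<lambda>z. restrict z {..<n}) ` {x \<in> Mn (n + N). P (restrict x {..<n})}"
    then show "x \<in> A" using assms(2) by (auto simp: Mn_def)
  next
    fix x assume x: "x \<in> A"
    define z where "z = restrict x {..<n + N}"
    have "restrict z {..<n} = x"
      using x assms(2) unfolding z_def by (auto simp: Mn_def PiE_iff extensional_def fun_eq_iff)
    moreover have "z \<in> Mn (n + N)" unfolding z_def by (auto simp: Mn_def)
    ultimately show "x \<in> (\<lambda>z. restrict z {..<n}) ` {x \<in> Mn (n + N). P (restrict x {..<n})}"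
      using x assms(2) by (intro image_eqI[of _ _ z]) auto
  qed
  ultimately show ?thesis by simp
qed

end

section \<open>O-minimality in one variable\<close>

definition tame :: "'a::linorder set \<Rightarrow> bool" where
  "tame A \<longleftrightarrow> (\<exists>F. finite F \<and> A = \<Union>F \<and> (\<forall>I\<in>F. (\<exists>c. I = {c}) \<or> is_open_interval I))"

lemma tame_induct [consumes 1, case_names empty point interval union]:
  assumes "tame A" "Q {}" "\<And>c. Q {c}" "\<And>I. is_open_interval I \<Longrightarrow> Q I"
    "\<And>A B. Q A \<Longrightarrow> Q B \<Longrightarrow> Q (A \<union> B)"
  shows "Q A"
proof -
  obtain F where F: "finite F" "A = \<Union>F" "\<forall>I\<in>F. (\<exists>c. I = {c}) \<or> is_open_interval I"
    using assms(1) unfolding tame_def by auto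
  have "Q (\<Union>F)" using F(1,3)
  proof (induction F rule: finite_induct)
    case (insert I F)
    then have "Q I" using assms(3)[of _] assms(4)[of I] by auto
    then show ?case using insert assms(5) by simp
  qed (simp add: assms(2))
  then show ?thesis using F by simp
qed

lemma open_interval_cases:
  assumes "is_open_interval I"
  obtains l r where "I = {l<..<r}" | l where "I = {l<..}" | r where "I = {..<r}" | "I = UNIV"
  using assms unfolding is_open_interval_def by blast

text \<open>Finitely many points and intervals have finitely many endpoints, and membership does not
  change between a and the next endpoint to its right.\<close>

lemma tame_germ:
  fixes A :: "'a::linordered_field set"
  assumes "tame A"
  shows "\<exists>b>a. {a<..<b} \<subseteq> A \<or> {a<..<b} \<inter> A = {}"
  using assms
proof (induction A rule: tame_induct)
  case empty
  then show ?case by (intro exI[of _ "a + 1"]) auto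
next
  case (point c)
  show ?case by (intro exI[of _ "if a < c then c else a + 1"]) auto
next
  case (interval I)
  then show ?case
  proof (cases rule: open_interval_cases)
    case (1 l r)
    then show ?thesis
      by (intro exI[of _ "if a < l then l else if a < r then r else a + 1"]) auto
  next
    case (2 l)
    then show ?thesis by (intro exI[of _ "if a < l then l else a + 1"]) auto
  next
    case (3 r)
    then show ?thesis by (intro exI[of _ "if a < r then r else a + 1"]) auto
  next
    case 4
    then show ?thesis by (intro exI[of _ "a + 1"]) auto
  qed
next
  case (union A B)
  then obtain b b' where b: "b > a" "{a<..<b} \<subseteq> A \<or> {a<..<b} \<inter> A = {}"
    "b' > a" "{a<..<b'} \<subseteq> B \<or> {a<..<b'} \<inter> B = {}" by auto
  have "{a<..<min b b'} = {a<..<b} \<inter> {a<..<b'}" by auto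
  with b show ?case by (intro exI[of _ "min b b'"]) auto
qed

lemma tame_glb:
  fixes A :: "'a::linordered_field set"
  assumes "tame A" "A \<noteq> {}" "\<And>x. x \<in> A \<Longrightarrow> l \<le> x"
  shows "\<exists>m. (\<forall>x\<in>A. m \<le> x) \<and> (\<forall>m'. (\<forall>x\<in>A. m' \<le> x) \<longrightarrow> m' \<le> m)"
proof -
  \<comment> \<open>Extended to empty sets and to sets unbounded below, so that the statement is
    closed under unions.\<close>
  have "A = {} \<or> (\<exists>m. (\<forall>x\<in>A. m \<le> x) \<and> (\<forall>m'. (\<forall>x\<in>A. m' \<le> x) \<longrightarrow> m' \<le> m))
      \<or> \<not> (\<exists>m. \<forall>x\<in>A. m \<le> x)" (is "?Q A")
    using assms(1)
  proof (induction A rule: tame_induct)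
    case (point c)
    then show ?case by auto
  next
    case (interval I)
    have l: "m \<le> l" if "l < r" "\<forall>x. l < x \<and> x < r \<longrightarrow> m \<le> x" for l r m :: 'a
    proof (rule ccontr)
      assume "\<not> m \<le> l"
      then have "l < min m r" using that(1) by simp
      then obtain x where "l < x" "x < m" "x < r" using dense[of l "min m r"] by auto
      then show False using that(2) by (meson leD)
    qed
    have u: "\<not> (\<forall>x<r. m \<le> x)" for r m :: 'a
      using lt_ex[of "min r m"] by (auto simp: not_le)
    show ?case using interval
    proof (cases rule: open_interval_cases)
      case (1 l r)
      show ?thesis
      proof (cases "l < r")
        case True
        then show ?thesis using l[of l r] 1 by (intro disjI2 disjI1 exI[of _ l]) auto
      qed (use 1 in auto)
    next
      case (2 k)
      then show ?thesis using l[of k "k + 1"] by (intro disjI2 disjI1 exI[of _ k]) auto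
    next
      case (3 r)
      then show ?thesis using u[of r] by auto
    next
      case 4
      then show ?thesis using lt_ex by (auto simp: not_le)
    qed
  next
    case (union A B)
    show ?case
    proof (cases "A = {} \<or> B = {}")
      case True
      with union show ?thesis by auto
    next
      case ne: False
      show ?thesis
      proof (cases "\<exists>m. \<forall>x\<in>A\<union>B. m \<le> x")
        case True
        then obtain mA mB where
          "\<forall>x\<in>A. mA \<le> x" "\<forall>m'. (\<forall>x\<in>A. m' \<le> x) \<longrightarrow> m' \<le> mA"
          "\<forall>x\<in>B. mB \<le> x" "\<forall>m'. (\<forall>x\<in>B. m' \<le> x) \<longrightarrow> m' \<le> mB"
          using union ne by auto
        then show ?thesis by (intro disjI2 disjI1 exI[of _ "min mA mB"]) (auto simp: min_le_iff_disj)
      qed auto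
    qed
  qed simp
  with assms show ?thesis by blast
qed

lemma tame_infinite:
  fixes A :: "'a::linordered_field set"
  assumes "tame A" "infinite A"
  shows "\<exists>a b. a < b \<and> {a<..<b} \<subseteq> A"
  using assms
proof (induction A rule: tame_induct)
  case (interval I)
  from this(1) show ?case
  proof (cases rule: open_interval_cases)
    case (1 l r)
    with interval(2) have "l < r" by (metis finite.emptyI greaterThanLessThan_empty not_le)
    with 1 show ?thesis by blast
  next
    case (2 l)
    then show ?thesis by (intro exI[of _ l] exI[of _ "l + 1"]) auto
  next
    case (3 r)
    then show ?thesis by (intro exI[of _ "r - 1"] exI[of _ r]) auto
  next
    case 4
    then show ?thesis by (intro exI[of _ 0] exI[of _ 1]) auto
  qed
next
  case (union A B)
  then show ?case by (metis Un_iff finite_UnI subset_iff)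
qed auto

section \<open>Formulas over the ordered field, and uniformity in one variable\<close>

locale omin_field =
  fixes S :: "nat \<Rightarrow> 'a::linordered_field tup set set"
  assumes omin: "o_minimal_expansion_rcf S"

sublocale omin_field \<subseteq> def_structure S
  using omin by unfold_locales (auto simp: o_minimal_expansion_rcf_def)

context omin_field
begin

lemma dpred_less [def_intros]:
  assumes "dterm s" "dterm t" shows "dpred (\<lambda>e. s e < t e)"
proof -
  have "{x \<in> Mn 2. x 0 < x 1} \<in> S 2" using omin unfolding o_minimal_expansion_rcf_def by blast
  then have "supp_def 2 (\<lambda>e. e 0 < e 1)" unfolding supp_def_def by auto
  then have "dpred (\<lambda>e. e 0 < e 1)" unfolding dpred_def by blast
  from dpred_binary[where R = "(<)", OF this assms] show ?thesis .
qed

lemma dpred_le [def_intros]: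
  assumes "dterm s" "dterm t" shows "dpred (\<lambda>e. s e \<le> t e)"
  using dpred_not[OF dpred_less[OF assms(2,1)]] by (simp add: not_less)

lemma dterm_add [def_intros]:
  assumes "dterm s" "dterm t" shows "dterm (\<lambda>e. s e + t e)"
proof -
  have "{x \<in> Mn 3. x 0 + x 1 = x 2} \<in> S 3" using omin unfolding o_minimal_expansion_rcf_def by blast
  then have "supp_def 3 (\<lambda>e. e 0 + e 1 = e 2)" unfolding supp_def_def by auto
  then have "dpred (\<lambda>e. e 0 + e 1 = e 2)" unfolding dpred_def by blast
  from dpred_rename[OF this, of "\<lambda>i. if i = 2 then 0 else Suc i"]
  have "dterm (\<lambda>e. e 0 + e 1)" unfolding dterm_def by (simp add: eq_commute)
  from dterm_binary[where f = "(+)", OF this assms] show ?thesis .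
qed

lemma dterm_mult [def_intros]:
  assumes "dterm s" "dterm t" shows "dterm (\<lambda>e. s e * t e)"
proof -
  have "{x \<in> Mn 3. x 0 * x 1 = x 2} \<in> S 3" using omin unfolding o_minimal_expansion_rcf_def by blast
  then have "supp_def 3 (\<lambda>e. e 0 * e 1 = e 2)" unfolding supp_def_def by auto
  then have "dpred (\<lambda>e. e 0 * e 1 = e 2)" unfolding dpred_def by blast
  from dpred_rename[OF this, of "\<lambda>i. if i = 2 then 0 else Suc i"]
  have "dterm (\<lambda>e. e 0 * e 1)" unfolding dterm_def by (simp add: eq_commute)
  from dterm_binary[where f = "(*)", OF this assms] show ?thesis .
qed

lemma dterm_diff [def_intros]:
  assumes "dterm s" "dterm t" shows "dterm (\<lambda>e. s e - t e)"
proof -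
  have "dpred (\<lambda>e. e 0 + e 2 = e 1)" by (intro def_intros)
  then have "dterm (\<lambda>e. e 0 - e 1)" unfolding dterm_def by (simp add: eq_diff_eq numeral_2_eq_2)
  from dterm_binary[where f = "(-)", OF this assms] show ?thesis .
qed

text \<open>O-minimality enters through this lemma. Parameters occur in Q as constant terms, so
  fibres of definable relations are covered too.\<close>

lemma tame_Collect:
  assumes "dpred (\<lambda>e. Q (e 0))" shows "tame {y. Q y}"
proof -
  have "{x \<in> Mn 1. Q (x 0)} \<in> S 1" using assms by (rule dpred_imp_S) auto
  moreover have "(\<lambda>x. x 0) ` {x \<in> Mn 1. Q (x 0)} = {y. Q y}"
  proof -
    have "(restrict (\<lambda>_. y) {..<1::nat}) 0 = y" "restrict (\<lambda>_. y) {..<1} \<in> Mn 1" for y :: 'a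
      by (simp_all add: Mn_def restrict_PiE_iff)
    then show ?thesis by (fastforce simp: image_iff)
  qed
  moreover have "\<forall>A\<in>S 1. tame ((\<lambda>x. x 0) ` A)"
    using omin unfolding o_minimal_expansion_rcf_def tame_def by (elim conjE)
  ultimately show ?thesis by metis
qed

text \<open>If no level set \<open>{y. r y c}\<close> contained an interval, they would all be finite; the set of
  their minima is infinite, hence contains an interval, and \<open>y\<close> moves to the left in it as \<open>c\<close>
  decreases, so that a single level set contains everything to the right of its minimum.\<close>

lemma uniform_interval:
  assumes r: "dpred (\<lambda>e. r (e 0) (e 1))"
    and mono: "\<And>y c c'. r y c \<Longrightarrow> 0 < c' \<Longrightarrow> c' \<le> c \<Longrightarrow> r y c'"
    and pq: "p < q" and ex: "\<And>y. p < y \<Longrightarrow> y < q \<Longrightarrow> \<exists>c>0. r y c"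
  shows "\<exists>p' q' c. p \<le> p' \<and> p' < q' \<and> q' \<le> q \<and> c > 0 \<and> (\<forall>y. p' < y \<and> y < q' \<longrightarrow> r y c)"
proof (rule ccontr)
  assume no: "\<not> ?thesis"
  define F where "F c = {y. p < y \<and> y < q \<and> r y c}" for c
  have rd [def_intros]: "dpred (\<lambda>e. r (s e) (t e))" if "dterm s" "dterm t" for s t
    using dpred_binary[OF r that] .
  have fin: "finite (F c)" if "c > 0" for c
  proof (rule ccontr)
    assume "infinite (F c)"
    moreover have "tame (F c)" unfolding F_def by (intro tame_Collect def_intros)
    ultimately obtain a b where ab: "a < b" "{a<..<b} \<subseteq> F c" using tame_infinite by blast
    then obtain m where "a < m" "m < b" using dense by blast
    then have "p < m" "m < q" using ab unfolding F_def by auto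
    with \<open>a < m\<close> \<open>m < b\<close> ab(2) that have "p \<le> max a p \<and> max a p < min b q \<and> min b q \<le> q \<and> c > 0
        \<and> (\<forall>y. max a p < y \<and> y < min b q \<longrightarrow> r y c)"
      unfolding F_def by auto
    with no show False by blast
  qed
  \<comment> \<open>The least elements of the level sets, spelled out as a formula to which
    \<open>def_intros\<close> applies.\<close>
  define K where "K = {y. \<exists>c. c > 0 \<and> (p < y \<and> y < q \<and> r y c)
    \<and> (\<forall>y'. y' < y \<longrightarrow> \<not> (p < y' \<and> y' < q \<and> r y' c))}"
  have K: "y \<in> K \<longleftrightarrow> (\<exists>c>0. y \<in> F c \<and> (\<forall>y'<y. y' \<notin> F c))" for y
    unfolding K_def F_def by auto
  have below: "\<exists>y1\<in>K. y1 \<le> y" if "p < y" "y < q" for y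
  proof -
    from ex that obtain c where c: "c > 0" "y \<in> F c" unfolding F_def by auto
    then have "Min (F c) \<in> F c" "\<forall>y'<Min (F c). y' \<notin> F c" "Min (F c) \<le> y"
      using fin by (auto intro: Min_in simp: not_le[symmetric])
    then show ?thesis using K c by blast
  qed
  have Kpq: "p < y \<and> y < q" if "y \<in> K" for y using that unfolding K F_def by auto
  \<comment> \<open>K is nonempty but has no least element: by \<open>below\<close> it has members
    at or below points arbitrarily close to p.\<close>
  have "infinite K"
  proof
    assume f: "finite K"
    moreover have "K \<noteq> {}" using below dense[OF pq] by auto
    ultimately have "Min K \<in> K" by auto
    then have "p < Min K" "Min K < q" using Kpq by auto
    then obtain y where y: "p < y" "y < Min K" using dense by blast
    then obtain y1 where "y1 \<in> K" "y1 \<le> y"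
      using below[of y] \<open>Min K < q\<close> by auto
    then show False using Min_le[OF f, of y1] y by auto
  qed
  moreover have "tame K" unfolding K_def by (intro tame_Collect def_intros)
  ultimately obtain a b where ab: "a < b" "{a<..<b} \<subseteq> K" using tame_infinite by blast
  then obtain m where m: "a < m" "m < b" using dense by blast
  then have "m \<in> K" using ab by auto
  then obtain c where c: "c > 0" "m \<in> F c" using K by blast
  \<comment> \<open>Each x here is least in some level \<open>F c'\<close>, which therefore omits m.
    Since m lies in \<open>F c\<close>, monotonicity forces \<open>c < c'\<close>, and then x lies
    in \<open>F c\<close> as well.\<close>
  have "{m<..<b} \<subseteq> F c"
  proof
    fix x assume x: "x \<in> {m<..<b}"
    with m ab have "x \<in> K" by auto
    then obtain c' where c': "c' > 0" "x \<in> F c'" "\<forall>y'<x. y' \<notin> F c'" using K by blast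
    with x have "m \<notin> F c'" by auto
    then have "\<not> c' \<le> c" using mono[of m c c'] c c'(1) unfolding F_def by auto
    then show "x \<in> F c" using mono[of x c' c] c c' unfolding F_def by auto
  qed
  then show False using fin[OF c(1)] infinite_Ioo[OF m(2)] finite_subset by blast
qed

end

section \<open>Definable functions on boxes\<close>

definition obox :: "nat \<Rightarrow> 'a::linorder tup \<Rightarrow> 'a tup \<Rightarrow> 'a tup set" where
  "obox n a b = {x \<in> Mn n. \<forall>i<n. a i < x i \<and> x i < b i}"

definition subbox :: "nat \<Rightarrow> 'a::linorder tup \<Rightarrow> 'a tup \<Rightarrow> 'a tup \<Rightarrow> 'a tup \<Rightarrow> bool" where
  "subbox n a b a' b' \<longleftrightarrow> (\<forall>i<n. a i \<le> a' i \<and> a' i < b' i \<and> b' i \<le> b i)"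

lemma subbox_refl: "(\<And>i. i < n \<Longrightarrow> a i < b i) \<Longrightarrow> subbox n a b a b"
  unfolding subbox_def by auto

lemma subbox_less: "subbox n a b a' b' \<Longrightarrow> i < n \<Longrightarrow> a' i < b' i"
  unfolding subbox_def by auto

lemma subbox_trans: "subbox n a b a' b' \<Longrightarrow> subbox n a' b' a'' b'' \<Longrightarrow> subbox n a b a'' b''"
  unfolding subbox_def by (meson order.trans)

lemma obox_mono: "subbox n a b a' b' \<Longrightarrow> x \<in> obox n a' b' \<Longrightarrow> x \<in> obox n a b"
  unfolding subbox_def obox_def by (auto intro: order.strict_trans1 order.strict_trans2)

lemma obox_nonempty:
  fixes a b :: "'a::linordered_field tup"
  assumes "\<And>i. i < n \<Longrightarrow> a i < b i"
  shows "\<exists>x. x \<in> obox n a b"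
proof -
  have "\<forall>i. \<exists>v. i < n \<longrightarrow> a i < v \<and> v < b i" using assms dense by blast
  then obtain x where "\<forall>i<n. a i < x i \<and> x i < b i" by metis
  then have "restrict x {..<n} \<in> obox n a b" unfolding obox_def Mn_def by auto
  then show ?thesis by blast
qed

lemma obox_Suc_iff:
  "x \<in> obox (Suc n) a b \<longleftrightarrow> (\<exists>x'\<in>obox n a b. \<exists>y. a n < y \<and> y < b n \<and> x = x'(n := y))"
proof
  assume x: "x \<in> obox (Suc n) a b"
  have "x = (restrict x {..<n})(n := x n)"
    using x by (auto simp: obox_def Mn_def PiE_iff extensional_def fun_eq_iff)
  moreover have "restrict x {..<n} \<in> obox n a b"
    using x by (auto simp: obox_def Mn_def)
  ultimately show "\<exists>x'\<in>obox n a b. \<exists>y. a n < y \<and> y < b n \<and> x = x'(n := y)"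
    using x unfolding obox_def by (intro bexI[of _ "restrict x {..<n}"] exI[of _ "x n"]) auto
next
  assume "\<exists>x'\<in>obox n a b. \<exists>y. a n < y \<and> y < b n \<and> x = x'(n := y)"
  then show "x \<in> obox (Suc n) a b"
    by (auto simp: obox_def Mn_def PiE_iff extensional_def less_Suc_eq)
qed

lemma obox_cong: "(\<And>i. i < n \<Longrightarrow> a i = a' i) \<Longrightarrow> (\<And>i. i < n \<Longrightarrow> b i = b' i) \<Longrightarrow> obox n a b = obox n a' b'"
  unfolding obox_def by auto

lemma subbox_Suc:
  assumes "subbox n a b a' b'" "a n \<le> p" "p < q" "q \<le> b n"
    "\<And>x y. x \<in> obox n a' b' \<Longrightarrow> p < y \<Longrightarrow> y < q \<Longrightarrow> P (x(n := y))"
  shows "\<exists>a'' b''. subbox (Suc n) a b a'' b'' \<and> (\<forall>x\<in>obox (Suc n) a'' b''. P x)"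
proof (intro exI conjI ballI)
  show "subbox (Suc n) a b (a'(n := p)) (b'(n := q))"
    using assms by (auto simp: subbox_def less_Suc_eq)
  fix x assume "x \<in> obox (Suc n) (a'(n := p)) (b'(n := q))"
  moreover have "obox n (a'(n := p)) (b'(n := q)) = obox n a' b'" by (rule obox_cong) auto
  ultimately show "P x" using assms(5) unfolding obox_Suc_iff by auto
qed

context omin_field
begin

lemma dterm_half [def_intros]: "dterm s \<Longrightarrow> dterm (\<lambda>e. s e / 2)"
  using dterm_mult[OF _ dterm_const[of "1/2"], of s] by simp

text \<open>Induction on n, the last coordinate being treated by \<open>uniform_interval\<close>.
  Above each x that lemma supplies an interval and a constant, both depending on x. They are made
  uniform in two stages, each an instance of the induction hypothesis: a starting point t that
  serves every x, then a number that serves as length and as constant.\<close>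

lemma uniform_subbox:
  assumes "dpred (\<lambda>e. R (\<lambda>i. e (Suc i)) (e 0))"
    and "\<And>x c c'. R x c \<Longrightarrow> 0 < c' \<Longrightarrow> c' \<le> c \<Longrightarrow> R x c'"
    and "\<And>i. i < n \<Longrightarrow> a i < b i"
    and "\<And>x. x \<in> obox n a b \<Longrightarrow> \<exists>c>0. R x c"
  shows "\<exists>a' b' c. 0 < c \<and> subbox n a b a' b' \<and> (\<forall>x\<in>obox n a' b'. R x c)"
  using assms
proof (induction n arbitrary: R a b)
  case 0
  have "obox 0 a b = {\<lambda>_. undefined}" unfolding obox_def Mn_def by auto
  with 0(4)[of "\<lambda>_. undefined"] show ?case unfolding subbox_def by (auto simp: obox_def Mn_def)
next
  case (Suc n)
  note Rd = Suc.prems(1) and Rm = Suc.prems(2) and Rx = Suc.prems(4)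
  have rd [def_intros]: "dpred (\<lambda>e. R (X e) (t e))"
    if "\<And>i. dterm (\<lambda>e. X e i)" "dterm t" for X t
    using dpred_app[of R, OF Rd that] .
  define l u where "l = a n" and "u = b n"
  have lu: "l < u" using Suc.prems(3) unfolding l_def u_def by auto
  \<comment> \<open>One number \<epsilon> is both the length of the interval to the right of t and
    the constant in R, so that \<open>G t\<close> is again inherited by smaller values.\<close>
  define G where "G t x \<epsilon> \<longleftrightarrow> (\<forall>y. t < y \<and> y < t + \<epsilon> \<longrightarrow> R (x(n := y)) \<epsilon>)" for t x \<epsilon>
  have Gm: "G t x \<epsilon>'" if "G t x \<epsilon>" "0 < \<epsilon>'" "\<epsilon>' \<le> \<epsilon>" for t x \<epsilon> \<epsilon>'
    unfolding G_def
  proof (intro allI impI)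
    fix y assume "t < y \<and> y < t + \<epsilon>'"
    then show "R (x(n := y)) \<epsilon>'" using that Rm unfolding G_def by auto
  qed
  have Gd [def_intros]: "dpred (\<lambda>e. G (t e) (X e) (s e))"
    if "\<And>i. dterm (\<lambda>e. X e i)" "dterm t" "dterm s" for X t s
    using that dterm_rename[OF that(1), of Suc] dterm_rename[OF that(2), of Suc] dterm_rename[OF that(3), of Suc]
    unfolding G_def by (intro def_intros)
  \<comment> \<open>The good starts t for a given x fill an interval just to the right of l. Its
    length \<delta> is monotone and can be made uniform, unlike a single choice of t.\<close>
  define R2 where "R2 x \<delta> \<longleftrightarrow> (\<forall>t. l < t \<and> t < u \<and> t < l + \<delta> \<longrightarrow> (\<exists>\<epsilon>. 0 < \<epsilon> \<and> G t x \<epsilon>))" for x \<delta>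
  have R2: "\<exists>\<delta>>0. R2 x \<delta>" if x: "x \<in> obox n a b" for x
  proof -
    let ?Z = "{t. \<exists>\<epsilon>. 0 < \<epsilon> \<and> G t x \<epsilon>}"
    have "tame ?Z" by (intro tame_Collect def_intros)
    then obtain b0 where b0: "l < b0" "{l<..<b0} \<subseteq> ?Z \<or> {l<..<b0} \<inter> ?Z = {}"
      using tame_germ by blast
    \<comment> \<open>The good starts either fill or avoid an interval beginning at l. They cannot
      avoid it, because \<open>uniform_interval\<close> on \<open>(l, min b0 u)\<close> produces a
      good start inside it.\<close>
    have "\<not> {l<..<b0} \<inter> ?Z = {}"
    proof
      assume no: "{l<..<b0} \<inter> ?Z = {}"
      have "\<exists>p' q' c. l \<le> p' \<and> p' < q' \<and> q' \<le> min b0 u \<and> c > 0 \<and> (\<forall>y. p' < y \<and> y < q' \<longrightarrow> R (x(n := y)) c)"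
      proof (rule uniform_interval)
        show "dpred (\<lambda>e. R (x(n := e 0)) (e 1))" by (intro def_intros)
        show "R (x(n := y)) c'" if "R (x(n := y)) c" "0 < c'" "c' \<le> c" for y c c'
          using Rm that by blast
        show "l < min b0 u" using b0 lu by auto
        show "\<exists>c>0. R (x(n := y)) c" if "l < y" "y < min b0 u" for y
        proof (rule Rx)
          show "x(n := y) \<in> obox (Suc n) a b"
            unfolding obox_Suc_iff using x that by (auto simp: l_def u_def)
        qed
      qed
      then obtain p' q' c where pq: "l \<le> p'" "p' < q'" "q' \<le> min b0 u" "c > 0"
        "\<And>y. p' < y \<Longrightarrow> y < q' \<Longrightarrow> R (x(n := y)) c" by blast
      then obtain t where t: "p' < t" "t < q'" using dense by blast
      \<comment> \<open>The length must stay within \<open>q' - t\<close> and the constant must be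
        at most c; the minimum meets both demands.\<close>
      have "G t x (min c (q' - t))"
        unfolding G_def
      proof (intro allI impI)
        fix y assume "t < y \<and> y < t + min c (q' - t)"
        then have "R (x(n := y)) c" using t by (intro pq(5)) auto
        then show "R (x(n := y)) (min c (q' - t))" by (rule Rm) (use pq t in auto)
      qed
      moreover have "0 < min c (q' - t)" using pq t by auto
      ultimately have "t \<in> ?Z" by blast
      moreover have "t \<in> {l<..<b0}" using t pq by auto
      ultimately show False using no by blast
    qed
    with b0 have "{l<..<b0} \<subseteq> ?Z" by blast
    then have "R2 x (b0 - l)" unfolding R2_def by auto
    with b0 show ?thesis by (intro exI[of _ "b0 - l"]) auto
  qed
  have "\<exists>a' b' c. 0 < c \<and> subbox n a b a' b' \<and> (\<forall>x\<in>obox n a' b'. R2 x c)"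
  proof (rule Suc.IH)
    show "dpred (\<lambda>e. R2 (\<lambda>i. e (Suc i)) (e 0))" unfolding R2_def by (intro def_intros)
    show "R2 x c'" if "R2 x c" "0 < c'" "c' \<le> c" for x c c'
      using that unfolding R2_def by (meson add_left_mono order.strict_trans2)
    show "a i < b i" if "i < n" for i using Suc.prems(3) that by simp
  qed (rule R2)
  then obtain a1 b1 \<delta> where 1: "0 < \<delta>" "subbox n a b a1 b1" "\<And>x. x \<in> obox n a1 b1 \<Longrightarrow> R2 x \<delta>"
    by blast
  \<comment> \<open>Being inside the box and within \<delta> of l, this t is a good start for every
    x of the subbox at once.\<close>
  obtain t where t: "l < t" "t < u" "t < l + \<delta>"
    using dense[of l "min u (l + \<delta>)"] lu 1(1) by auto
  have "\<exists>a' b' c. 0 < c \<and> subbox n a1 b1 a' b' \<and> (\<forall>x\<in>obox n a' b'. G t x c)"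
  proof (rule Suc.IH)
    show "dpred (\<lambda>e. G t (\<lambda>i. e (Suc i)) (e 0))" by (intro def_intros)
    show "\<exists>c>0. G t x c" if "x \<in> obox n a1 b1" for x
      using 1(3)[OF that] t unfolding R2_def by blast
  qed (use Gm subbox_less[OF 1(2)] in blast)+
  then obtain a2 b2 \<epsilon> where 2: "0 < \<epsilon>" "subbox n a1 b1 a2 b2" "\<And>x. x \<in> obox n a2 b2 \<Longrightarrow> G t x \<epsilon>"
    by blast
  have "\<exists>a'' b''. subbox (Suc n) a b a'' b'' \<and> (\<forall>x\<in>obox (Suc n) a'' b''. R x \<epsilon>)"
  proof (rule subbox_Suc)
    show "subbox n a b a2 b2" using subbox_trans 1 2 by blast
    show "a n \<le> t" "t < min u (t + \<epsilon>)" "min u (t + \<epsilon>) \<le> b n"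
      using t 2(1) unfolding l_def u_def by auto
    show "R (x(n := y)) \<epsilon>" if "x \<in> obox n a2 b2" "t < y" "y < min u (t + \<epsilon>)" for x y
      using 2(3)[OF that(1)] that(2,3) unfolding G_def by auto
  qed
  with 2(1) show ?case by blast
qed

text \<open>Induction on n, applied to the predicate Q that P holds on the line above x immediately
  to the right of \<open>a n\<close>. Where Q fails throughout, \<open>tame_germ\<close> makes the
  negation of P hold there instead. In both cases \<open>uniform_subbox\<close> makes the length of
  the germ uniform.\<close>

lemma dichotomy_subbox:
  assumes "dpred P" "\<And>i. i < n \<Longrightarrow> a i < b i"
  shows "\<exists>a' b'. subbox n a b a' b' \<and> ((\<forall>x\<in>obox n a' b'. P x) \<or> (\<forall>x\<in>obox n a' b'. \<not> P x))"
  using assms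
proof (induction n arbitrary: P a b)
  case 0
  have "obox 0 a b = {\<lambda>_. undefined}" for a b :: "'a tup" unfolding obox_def Mn_def by auto
  then show ?case unfolding subbox_def by auto
next
  case (Suc n)
  \<comment> \<open>Stated for an arbitrary predicate because it serves P as well as its
    negation.\<close>
  have germ: "\<exists>a'' b''. subbox (Suc n) a b a'' b'' \<and> (\<forall>x\<in>obox (Suc n) a'' b''. P x)"
    if P: "dpred P" and sub: "subbox n a b a1 b1"
      and ex: "\<And>x. x \<in> obox n a1 b1 \<Longrightarrow> \<exists>c>0. \<forall>y. a n < y \<and> y < a n + c \<longrightarrow> P (x(n := y))" for P a1 b1
  proof -
    have [def_intros]: "dpred (\<lambda>e. P (X e))" if "\<And>i. dterm (\<lambda>e. X e i)" for X
      using dpred_subst[OF P that] .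
    have "\<exists>a' b' c. 0 < c \<and> subbox n a1 b1 a' b' \<and>
        (\<forall>x\<in>obox n a' b'. \<forall>y. a n < y \<and> y < a n + c \<longrightarrow> P (x(n := y)))"
      using ex subbox_less[OF sub] by (intro uniform_subbox def_intros) auto
    then obtain a2 b2 c where 2: "0 < c" "subbox n a1 b1 a2 b2"
      "\<And>x y. x \<in> obox n a2 b2 \<Longrightarrow> a n < y \<Longrightarrow> y < a n + c \<Longrightarrow> P (x(n := y))" by blast
    show ?thesis
    proof (rule subbox_Suc)
      show "subbox n a b a2 b2" using subbox_trans sub 2 by blast
      show "a n \<le> a n" "a n < min (b n) (a n + c)" "min (b n) (a n + c) \<le> b n"
        using Suc.prems(2) 2(1) by auto
      show "P (x(n := y))" if "x \<in> obox n a2 b2" "a n < y" "y < min (b n) (a n + c)" for x y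
        using 2(3) that by auto
    qed
  qed
  have [def_intros]: "dpred (\<lambda>e. P (X e))" if "\<And>i. dterm (\<lambda>e. X e i)" for X
    using dpred_subst[OF Suc.prems(1) that] .
  define Q where "Q x \<longleftrightarrow> (\<exists>c. 0 < c \<and> (\<forall>y. a n < y \<and> y < a n + c \<longrightarrow> P (x(n := y))))" for x
  have "dpred Q" unfolding Q_def by (intro def_intros)
  then obtain a1 b1 where 1: "subbox n a b a1 b1"
    "(\<forall>x\<in>obox n a1 b1. Q x) \<or> (\<forall>x\<in>obox n a1 b1. \<not> Q x)"
    using Suc.IH[of Q a b] Suc.prems(2) by auto
  from 1(2) show ?case
  proof
    assume "\<forall>x\<in>obox n a1 b1. Q x"
    then show ?thesis using germ[OF Suc.prems(1) 1(1)] unfolding Q_def by blast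
  next
    assume nQ: "\<forall>x\<in>obox n a1 b1. \<not> Q x"
    have "\<exists>c>0. \<forall>y. a n < y \<and> y < a n + c \<longrightarrow> \<not> P (x(n := y))" if "x \<in> obox n a1 b1" for x
    proof -
      let ?Z = "{y. P (x(n := y))}"
      have "tame ?Z" by (intro tame_Collect def_intros)
      then obtain b0 where b0: "a n < b0" "{a n<..<b0} \<subseteq> ?Z \<or> {a n<..<b0} \<inter> ?Z = {}"
        using tame_germ by blast
      have "\<not> {a n<..<b0} \<subseteq> ?Z"
      proof
        assume "{a n<..<b0} \<subseteq> ?Z"
        then have "Q x" unfolding Q_def using b0 by (intro exI[of _ "b0 - a n"]) auto
        then show False using nQ that by blast
      qed
      with b0(2) have "\<forall>y\<in>{a n<..<b0}. y \<notin> ?Z" by blast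
      then have "\<forall>y. a n < y \<and> y < a n + (b0 - a n) \<longrightarrow> \<not> P (x(n := y))" by simp
      with b0 show ?thesis using b0(1) by (meson diff_gt_0_iff_gt)
    qed
    from germ[OF dpred_not[OF Suc.prems(1)] 1(1) this] show ?thesis by blast
  qed
qed

lemma finite_cover_subbox:
  assumes "finite F" "\<And>U. U \<in> F \<Longrightarrow> dpred (P U)" "\<And>i. i < n \<Longrightarrow> a i < b i"
    "\<And>x. x \<in> obox n a b \<Longrightarrow> \<exists>U\<in>F. P U x"
  shows "\<exists>U\<in>F. \<exists>a' b'. subbox n a b a' b' \<and> (\<forall>x\<in>obox n a' b'. P U x)"
  using assms
proof (induction F arbitrary: a b rule: finite_induct)
  case empty
  then show ?case using obox_nonempty[of n a b] by auto
next
  case (insert U F)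
  obtain a1 b1 where 1: "subbox n a b a1 b1"
    "(\<forall>x\<in>obox n a1 b1. P U x) \<or> (\<forall>x\<in>obox n a1 b1. \<not> P U x)"
    using dichotomy_subbox[of "P U" n a b] insert.prems by auto
  from 1(2) show ?case
  proof
    assume "\<forall>x\<in>obox n a1 b1. P U x"
    then show ?thesis using 1(1) by blast
  next
    assume "\<forall>x\<in>obox n a1 b1. \<not> P U x"
    then have "\<exists>U\<in>F. P U x" if "x \<in> obox n a1 b1" for x
      using insert.prems(3) obox_mono[OF 1(1) that] that by blast
    then obtain U' a2 b2 where "U' \<in> F" "subbox n a1 b1 a2 b2" "\<forall>x\<in>obox n a2 b2. P U' x"
      using insert.IH[of a1 b1] insert.prems(1) subbox_less[OF 1(1)] by blast
    then show ?thesis using subbox_trans[OF 1(1)] by blast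
  qed
qed

end

section \<open>Continuity of definable functions on a subbox\<close>

definition near :: "nat \<Rightarrow> 'a::linordered_field \<Rightarrow> 'a tup \<Rightarrow> 'a tup \<Rightarrow> bool" where
  "near n \<epsilon> x y \<longleftrightarrow> (\<forall>i<n. x i - \<epsilon> < y i \<and> y i < x i + \<epsilon>)"

text \<open>Phrased with sums and differences in place of absolute values, so that
  \<open>def_intros\<close> proves its definability.\<close>

definition cts_at :: "nat \<Rightarrow> ('a::linordered_field tup \<Rightarrow> 'a) \<Rightarrow> 'a tup \<Rightarrow> bool" where
  "cts_at n f x \<longleftrightarrow> (\<forall>\<delta>. 0 < \<delta> \<longrightarrow>
     (\<exists>\<epsilon>. 0 < \<epsilon> \<and> (\<forall>y\<in>Mn n. near n \<epsilon> x y \<longrightarrow> f x - \<delta> < f y \<and> f y < f x + \<delta>)))"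

lemma near_mono: "near n \<epsilon> x y \<Longrightarrow> \<epsilon> \<le> \<epsilon>' \<Longrightarrow> near n \<epsilon>' x y"
  unfolding near_def
  by (meson add_left_mono diff_left_mono order.strict_trans1 order.strict_trans2)

lemma uniform_positive:
  fixes g :: "nat \<Rightarrow> 'a::linordered_field"
  assumes "\<And>i. i < n \<Longrightarrow> 0 < g i"
  shows "\<exists>\<epsilon>>0. \<forall>i<n. \<epsilon> \<le> g i"
  using assms
proof (induction n)
  case 0
  show ?case by (intro exI[of _ 1]) auto
next
  case (Suc n)
  then obtain \<epsilon> where "\<epsilon> > 0" "\<forall>i<n. \<epsilon> \<le> g i" by auto
  with Suc.prems show ?case
    by (intro exI[of _ "min \<epsilon> (g n)"]) (auto simp: less_Suc_eq min_le_iff_disj)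
qed

lemma near_obox:
  fixes a b :: "'a::linordered_field tup"
  assumes "x \<in> obox n a b"
  shows "\<exists>\<epsilon>>0. \<forall>y\<in>Mn n. near n \<epsilon> x y \<longrightarrow> y \<in> obox n a b"
proof -
  have "\<exists>\<epsilon>>0. \<forall>i<n. \<epsilon> \<le> min (x i - a i) (b i - x i)"
    using assms by (intro uniform_positive) (auto simp: obox_def)
  then obtain \<epsilon> where \<epsilon>: "\<epsilon> > 0" "\<forall>i<n. \<epsilon> \<le> min (x i - a i) (b i - x i)" by auto
  have "y \<in> obox n a b" if "y \<in> Mn n" "near n \<epsilon> x y" for y
    unfolding obox_def
  proof (intro CollectI conjI allI impI that(1))
    fix i assume "i < n"
    then have "\<epsilon> \<le> x i - a i" "\<epsilon> \<le> b i - x i" "x i - \<epsilon> < y i" "y i < x i + \<epsilon>"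
      using \<epsilon>(2) that(2) unfolding near_def by auto
    then show "a i < y i" "y i < b i" by linarith+
  qed
  with \<epsilon>(1) show ?thesis by blast
qed

context omin_field
begin

lemma dterm_restrict_shift: "dterm t \<Longrightarrow> dterm (\<lambda>e. t (restrict e {..<n}))"
  by (rule dterm_subst[where T = "\<lambda>e. restrict e {..<n}"], assumption) (intro def_intros)

lemma dpred_near [def_intros]:
  assumes "\<And>i. dterm (\<lambda>e. X e i)" "\<And>i. dterm (\<lambda>e. Y e i)" "dterm s"
  shows "dpred (\<lambda>e. near n (s e) (X e) (Y e))"
  unfolding near_def by (intro def_intros assms)

text \<open>The values on the box form a definable set bounded below, so \<open>tame_glb\<close>
  gives an infimum. It may not be attained, but some value lies within \<delta> of it.\<close>

lemma almost_minimum: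
  assumes g: "dterm g" and ab: "\<And>i. i < n \<Longrightarrow> a i < b i"
    and bd: "\<And>x. x \<in> obox n a b \<Longrightarrow> L \<le> g x" and "0 < \<delta>"
  shows "\<exists>x\<in>obox n a b. \<forall>y\<in>obox n a b. g x - \<delta> < g y"
proof -
  let ?A = "{v. \<exists>x\<in>Mn n. (\<forall>i<n. a i < x i \<and> x i < b i) \<and> v = g x}"
  have gd: "dterm (\<lambda>e. g (restrict e {..<n}))" using g by (rule dterm_restrict_shift)
  have "tame ?A" by (intro tame_Collect def_intros gd)
  moreover have A: "?A = g ` obox n a b" unfolding obox_def by auto
  moreover have "?A \<noteq> {}" unfolding A using obox_nonempty[of n a b] ab by auto
  ultimately obtain m where m: "\<forall>x\<in>obox n a b. m \<le> g x"
      "\<And>m'. \<forall>x\<in>obox n a b. m' \<le> g x \<Longrightarrow> m' \<le> m"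
    using tame_glb[of ?A L] bd by auto
  have "\<not> m + \<delta> \<le> m" using \<open>0 < \<delta>\<close> by simp
  then obtain x where "x \<in> obox n a b" "g x < m + \<delta>" using m(2)[of "m + \<delta>"] by (meson not_le)
  moreover have "g x - \<delta> < g y" if "y \<in> obox n a b" for y
    using m(1) that \<open>g x < m + \<delta>\<close> by (auto simp: less_diff_eq diff_less_eq intro: order.strict_trans2)
  ultimately show ?thesis by blast
qed

text \<open>If \<open>f\<close> were discontinuous throughout a box, then on a smaller box it would be bounded and jump
  by at least a fixed \<open>\<delta>\<close> near every point, always upwards or always downwards; this is
  impossible at a point where \<open>f\<close> is within \<open>\<delta>\<close> of its supremum or infimum.\<close>

lemma continuous_subbox:
  assumes f: "dterm f" and ab: "\<And>i. i < n \<Longrightarrow> a i < b i"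
  shows "\<exists>a' b'. subbox n a b a' b' \<and> (\<forall>x\<in>obox n a' b'. cts_at n f x)"
proof -
  have fd [def_intros]: "dterm (\<lambda>e. f (X e))" if "\<And>i. dterm (\<lambda>e. X e i)" for X
    using dterm_subst[OF f that] .
  have "dpred (cts_at n f)" unfolding cts_at_def by (intro def_intros)
  then obtain a1 b1 where 1: "subbox n a b a1 b1"
    "(\<forall>x\<in>obox n a1 b1. cts_at n f x) \<or> (\<forall>x\<in>obox n a1 b1. \<not> cts_at n f x)"
    using dichotomy_subbox[of "cts_at n f" n a b] ab by blast
  have False if nc: "\<forall>x\<in>obox n a1 b1. \<not> cts_at n f x"
  proof -
    \<comment> \<open>Discontinuity with a fixed jump size \<delta>; it is inherited by smaller
      \<delta> and can therefore be made uniform.\<close>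
    define R where "R x \<delta> \<longleftrightarrow> (\<forall>\<epsilon>. 0 < \<epsilon> \<longrightarrow>
      (\<exists>y\<in>Mn n. near n \<epsilon> x y \<and> (f y \<le> f x - \<delta> \<or> f x + \<delta> \<le> f y)))" for x \<delta>
    have "\<exists>a' b' c. 0 < c \<and> subbox n a1 b1 a' b' \<and> (\<forall>x\<in>obox n a' b'. R x c)"
    proof (rule uniform_subbox)
      show "dpred (\<lambda>e. R (\<lambda>i. e (Suc i)) (e 0))" unfolding R_def by (intro def_intros)
      show "R x c'" if R: "R x c" and "0 < c'" and le: "c' \<le> c" for x c c'
        unfolding R_def
      proof (intro allI impI)
        fix \<epsilon> :: 'a assume "0 < \<epsilon>"
        then obtain y where "y \<in> Mn n" "near n \<epsilon> x y" "f y \<le> f x - c \<or> f x + c \<le> f y"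
          using R unfolding R_def by blast
        moreover from this(3) have "f y \<le> f x - c' \<or> f x + c' \<le> f y" using le by linarith
        ultimately show "\<exists>y\<in>Mn n. near n \<epsilon> x y \<and> (f y \<le> f x - c' \<or> f x + c' \<le> f y)" by blast
      qed
      show "\<exists>c>0. R x c" if "x \<in> obox n a1 b1" for x
        using nc that unfolding cts_at_def R_def by (meson not_le)
    qed (rule subbox_less[OF 1(1)])
    then obtain a2 b2 \<delta> where 2: "0 < \<delta>" "subbox n a1 b1 a2 b2" "\<And>x. x \<in> obox n a2 b2 \<Longrightarrow> R x \<delta>"
      by blast
    \<comment> \<open>This bounds f by \<open>1 / c\<close> in absolute value. The constant is the
      reciprocal of the bound because the condition must be inherited by smaller c; at a single
      point \<open>1 / (1 + \<bar>f x\<bar>)\<close> works. The negative is written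
      \<open>0 - c * f x\<close> to fit \<open>def_intros\<close>.\<close>
    have "\<exists>a' b' c. 0 < c \<and> subbox n a2 b2 a' b' \<and> (\<forall>x\<in>obox n a' b'. 0 - c * f x \<le> 1 \<and> c * f x \<le> 1)"
    proof (rule uniform_subbox)
      show "dpred (\<lambda>e. 0 - e 0 * f (\<lambda>i. e (Suc i)) \<le> 1 \<and> e 0 * f (\<lambda>i. e (Suc i)) \<le> 1)"
        by (intro def_intros)
      show "0 - c' * f x \<le> 1 \<and> c' * f x \<le> 1" if "0 - c * f x \<le> 1 \<and> c * f x \<le> 1" "0 < c'" "c' \<le> c" for x c c'
      proof (cases "0 \<le> f x")
        case True
        then have "c' * f x \<le> c * f x" "0 \<le> c' * f x" using that by (auto intro: mult_right_mono)
        then show ?thesis using that by auto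
      next
        case False
        then have "c * f x \<le> c' * f x" "c' * f x \<le> 0"
          using that by (auto intro: mult_right_mono_neg simp: mult_le_0_iff)
        then show ?thesis using that by auto
      qed
      show "\<exists>c>0. 0 - c * f x \<le> 1 \<and> c * f x \<le> 1" for x
      proof -
        have "0 < 1 + \<bar>f x\<bar>" by (simp add: add_pos_nonneg)
        moreover from this have "0 - f x / (1 + \<bar>f x\<bar>) \<le> 1" "f x / (1 + \<bar>f x\<bar>) \<le> 1"
          by (auto simp: field_simps)
        ultimately show ?thesis by (intro exI[of _ "1 / (1 + \<bar>f x\<bar>)"]) auto
      qed
    qed (rule subbox_less[OF 2(2)])
    then obtain a3 b3 c where 3: "0 < c" "subbox n a2 b2 a3 b3"
      "\<And>x. x \<in> obox n a3 b3 \<Longrightarrow> - (1 / c) \<le> f x" "\<And>x. x \<in> obox n a3 b3 \<Longrightarrow> - (1 / c) \<le> 0 - f x"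
      by (auto simp: field_simps)
    define Up where "Up x \<longleftrightarrow> (\<forall>\<epsilon>. 0 < \<epsilon> \<longrightarrow> (\<exists>y\<in>Mn n. near n \<epsilon> x y \<and> f x + \<delta> \<le> f y))" for x
    have "dpred Up" unfolding Up_def by (intro def_intros)
    then obtain a4 b4 where 4: "subbox n a3 b3 a4 b4"
      "(\<forall>x\<in>obox n a4 b4. Up x) \<or> (\<forall>x\<in>obox n a4 b4. \<not> Up x)"
      using dichotomy_subbox[of Up n a3 b3] subbox_less[OF 3(2)] by blast
    from 4(2) show False
    proof
      assume up: "\<forall>x\<in>obox n a4 b4. Up x"
      \<comment> \<open>An almost maximum of f, found as an almost minimum of its negative; an
        upward jump by \<delta> from it is impossible.\<close>
      obtain x where x: "x \<in> obox n a4 b4" "\<And>y. y \<in> obox n a4 b4 \<Longrightarrow> (0 - f x) - \<delta> < 0 - f y"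
        using almost_minimum[of "\<lambda>x. 0 - f x" n a4 b4 "- (1 / c)" \<delta>] subbox_less[OF 4(1)]
          3(4)[OF obox_mono[OF 4(1)]] 2(1) dterm_diff[OF dterm_const f] by blast
      obtain \<epsilon> where "\<epsilon> > 0" "\<forall>y\<in>Mn n. near n \<epsilon> x y \<longrightarrow> y \<in> obox n a4 b4" using near_obox[OF x(1)] by blast
      then obtain y where "y \<in> obox n a4 b4" "f x + \<delta> \<le> f y" using up x(1) unfolding Up_def by blast
      then show False using x(2)[of y] by linarith
    next
      assume nup: "\<forall>x\<in>obox n a4 b4. \<not> Up x"
      obtain x where x: "x \<in> obox n a4 b4" "\<And>y. y \<in> obox n a4 b4 \<Longrightarrow> f x - \<delta> < f y"
        using almost_minimum[of f n a4 b4 "- (1 / c)" \<delta>] subbox_less[OF 4(1)]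
          3(3)[OF obox_mono[OF 4(1)]] 2(1) f by blast
      obtain \<epsilon> where \<epsilon>: "\<epsilon> > 0" "\<forall>y\<in>Mn n. near n \<epsilon> x y \<longrightarrow> y \<in> obox n a4 b4" using near_obox[OF x(1)] by blast
      obtain \<epsilon>' where \<epsilon>': "\<epsilon>' > 0" "\<forall>y\<in>Mn n. near n \<epsilon>' x y \<longrightarrow> \<not> f x + \<delta> \<le> f y"
        using nup x(1) unfolding Up_def by blast
      \<comment> \<open>There is a jump of size \<delta> at every scale. Within \<epsilon>' of x it
        cannot go up, so it goes down, below what the almost minimal value permits.\<close>
      have "R x \<delta>" using 2(3) obox_mono[OF subbox_trans[OF 3(2) 4(1)] x(1)] by blast
      moreover have "0 < min \<epsilon> \<epsilon>'" using \<epsilon> \<epsilon>' by auto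
      ultimately obtain y where y: "y \<in> Mn n" "near n (min \<epsilon> \<epsilon>') x y" "f y \<le> f x - \<delta> \<or> f x + \<delta> \<le> f y"
        unfolding R_def by blast
      then have "near n \<epsilon> x y" "near n \<epsilon>' x y" using near_mono by (meson min.cobounded1 min.cobounded2)+
      then have "y \<in> obox n a4 b4" "f y \<le> f x - \<delta>" using y \<epsilon> \<epsilon>' by auto
      then show False using x(2)[of y] by linarith
    qed
  qed
  with 1 show ?thesis by blast
qed

lemma continuous_subbox_many:
  assumes "\<And>j. j < (d::nat) \<Longrightarrow> dterm (f j)" and "\<And>i. i < n \<Longrightarrow> a i < b i"
  shows "\<exists>a' b'. subbox n a b a' b' \<and> (\<forall>x\<in>obox n a' b'. \<forall>j<d. cts_at n (f j) x)"
  using assms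
proof (induction d)
  case 0
  then show ?case using subbox_refl[of n a b] by auto
next
  case (Suc d)
  then obtain a1 b1 where 1: "subbox n a b a1 b1" "\<forall>x\<in>obox n a1 b1. \<forall>j<d. cts_at n (f j) x" by auto
  obtain a2 b2 where 2: "subbox n a1 b1 a2 b2" "\<forall>x\<in>obox n a2 b2. cts_at n (f d) x"
    using continuous_subbox[of "f d" n a1 b1] Suc.prems(1)[of d] subbox_less[OF 1(1)] by blast
  have "\<forall>x\<in>obox n a2 b2. \<forall>j<Suc d. cts_at n (f j) x"
    using 1(2) 2(2) obox_mono[OF 2(1)] by (auto simp: less_Suc_eq)
  then show ?case using subbox_trans[OF 1(1) 2(1)] by blast
qed

section \<open>Definable choice\<close>

text \<open>The graph of \<open>THE y. P y e\<close> is P itself, so the term inherits definability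
  from P.\<close>

lemma dterm_the:
  assumes P: "dpred (\<lambda>e. P (e 0) (\<lambda>i. e (Suc i)))" and ex: "\<And>e. \<exists>!y. P y e"
  shows "\<exists>t. dterm t \<and> (\<forall>e. P (t e) e)"
proof (intro exI conjI allI)
  have "(y = (THE y. P y e)) = P y e" for y e using ex[of e] by (metis theI' the1_equality)
  then show "dterm (\<lambda>e. THE y. P y e)" unfolding dterm_def using P by simp
  show "P (THE y. P y e) e" for e using theI'[OF ex[of e]] .
qed

definition is_glb :: "'a set \<Rightarrow> 'a \<Rightarrow> bool" where
  "is_glb A m \<longleftrightarrow> (\<forall>x. x \<in> A \<longrightarrow> m \<le> x) \<and> (\<forall>m'. (\<forall>x. x \<in> A \<longrightarrow> m' \<le> x) \<longrightarrow> m' \<le> m)"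

lemma dterm_glb:
  assumes P: "dpred (\<lambda>e. P (e 0) (\<lambda>i. e (Suc i)))"
  shows "\<exists>t. dterm t \<and> (\<forall>e. (\<exists>m. is_glb {y. P y e} m) \<longrightarrow> is_glb {y. P y e} (t e))"
proof -
  have Pd [def_intros]: "dpred (\<lambda>e. P (s e) (X e))" if "\<And>i. dterm (\<lambda>e. X e i)" "dterm s" for X s
    using dpred_app[where R = "\<lambda>x y. P y x", OF P that] .
  have gd [def_intros]: "dpred (\<lambda>e. is_glb {y. P y (X e)} (s e))" if "\<And>i. dterm (\<lambda>e. X e i)" "dterm s" for X s
    using dterm_rename[OF that(1), of Suc] dterm_rename[OF that(2), of Suc]
      dterm_rename[OF that(1), of "\<lambda>i. Suc (Suc i)"]
    unfolding is_glb_def mem_Collect_eq by (intro def_intros)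
  \<comment> \<open>The value 0 where no greatest lower bound exists makes m unique for every e, as
    \<open>dterm_the\<close> demands.\<close>
  define Q where "Q m e \<longleftrightarrow> is_glb {y. P y e} m \<or> (\<not> (\<exists>m. is_glb {y. P y e} m) \<and> m = 0)" for m e
  have "\<exists>t. dterm t \<and> (\<forall>e. Q (t e) e)"
  proof (rule dterm_the)
    show "dpred (\<lambda>e. Q (e 0) (\<lambda>i. e (Suc i)))" unfolding Q_def by (intro def_intros)
    have "m = m'" if "is_glb A m" "is_glb A m'" for A and m m' :: 'a
      using that unfolding is_glb_def by (simp add: order.antisym)
    then show "\<exists>!y. Q y e" for e unfolding Q_def by blast
  qed
  then show ?thesis unfolding Q_def by blast
qed

text \<open>The infimum t0 of the fibre is chosen if it belongs to the fibre. Otherwise an interval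
  to the right of t0 lies in the fibre, and with t1 the infimum of the set B of points beyond t0
  where P fails, the midpoint of t0 and t1 satisfies P; if B is empty, \<open>t0 + 1\<close> does.
  Nonnegativity ensures that t0 exists.\<close>

lemma choice_nonneg:
  assumes P: "dpred (\<lambda>e. P (e 0) (\<lambda>i. e (Suc i)))" and pos: "\<And>y e. P y e \<Longrightarrow> 0 \<le> y"
  shows "\<exists>t. dterm t \<and> (\<forall>e. (\<exists>y. P y e) \<longrightarrow> P (t e) e)"
proof -
  have Pd [def_intros]: "dpred (\<lambda>e. P (s e) (X e))" if "\<And>i. dterm (\<lambda>e. X e i)" "dterm s" for X s
    using dpred_app[where R = "\<lambda>x y. P y x", OF P that] .
  have tm: "tame {y. P y e}" for e by (intro tame_Collect def_intros)
  obtain t0 where t0: "dterm t0" "\<And>e m. is_glb {y. P y e} m \<Longrightarrow> is_glb {y. P y e} (t0 e)"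
    using dterm_glb[of P, OF P] by blast
  define B where "B y e \<longleftrightarrow> t0 e < y \<and> \<not> P y e" for y e
  have Bd: "dpred (\<lambda>e. B (e 0) (\<lambda>i. e (Suc i)))"
    unfolding B_def by (intro def_intros dterm_rename[OF t0(1)])
  have Bd' [def_intros]: "dpred (\<lambda>e. B (s e) (X e))" if "\<And>i. dterm (\<lambda>e. X e i)" "dterm s" for X s
    using dpred_app[where R = "\<lambda>x y. B y x", OF Bd that] .
  have Bt: "tame {y. B y e}" for e by (intro tame_Collect def_intros)
  obtain t1 where t1: "dterm t1" "\<And>e m. is_glb {y. B y e} m \<Longrightarrow> is_glb {y. B y e} (t1 e)"
    using dterm_glb[of B, OF Bd] by blast
  define t where "t e = (if P (t0 e) e then t0 e else if \<exists>y. B y e then (t0 e + t1 e) / 2 else t0 e + 1)" for e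
  have "dterm t" unfolding t_def
    by (intro def_intros t0(1) t1(1))
  moreover have "P (t e) e" if "\<exists>y. P y e" for e
  proof (cases "P (t0 e) e")
    case True
    then show ?thesis unfolding t_def by simp
  next
    case nP: False
    have g0: "is_glb {y. P y e} (t0 e)"
    proof -
      have "\<exists>m. is_glb {y. P y e} m"
        using tame_glb[OF tm[of e], of 0] that pos unfolding is_glb_def by auto
      then show ?thesis using t0(2) by blast
    qed
    show ?thesis
    proof (cases "\<exists>y. B y e")
      case False
      then have "P (t0 e + 1) e" unfolding B_def by (meson less_add_one)
      then show ?thesis unfolding t_def using nP False by simp
    next
      case True
      have "\<exists>m. is_glb {y. B y e} m"
        using tame_glb[OF Bt[of e], of "t0 e"] True unfolding is_glb_def B_def by auto
      then have g1: "is_glb {y. B y e} (t1 e)" using t1(2) by blast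
      obtain b where b: "t0 e < b" "{t0 e<..<b} \<subseteq> {y. P y e} \<or> {t0 e<..<b} \<inter> {y. P y e} = {}"
        using tame_germ[OF tm[of e]] by blast
      \<comment> \<open>An interval free of P to the right of t0 would make b a lower bound larger
        than the infimum.\<close>
      have "\<not> {t0 e<..<b} \<inter> {y. P y e} = {}"
      proof
        assume dis: "{t0 e<..<b} \<inter> {y. P y e} = {}"
        have "b \<le> y" if "P y e" for y
        proof -
          have "t0 e \<le> y" using g0 that unfolding is_glb_def by blast
          moreover have "y \<noteq> t0 e" using nP that by auto
          moreover have "y \<notin> {t0 e<..<b}" using dis that by blast
          ultimately show ?thesis by simp
        qed
        then have "b \<le> t0 e" using g0 unfolding is_glb_def by blast
        with b show False by simp
      qed
      with b have sub: "{t0 e<..<b} \<subseteq> {y. P y e}" by blast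
      have "b \<le> y" if "B y e" for y
        using that sub unfolding B_def by (meson greaterThanLessThan_iff mem_Collect_eq not_le subsetD)
      then have "b \<le> t1 e" using g1 unfolding is_glb_def by blast
      then have lt: "t0 e < (t0 e + t1 e) / 2" "(t0 e + t1 e) / 2 < t1 e" using b(1) by auto
      then have "\<not> B ((t0 e + t1 e) / 2) e" using g1 unfolding is_glb_def by (meson leD mem_Collect_eq)
      then have "P ((t0 e + t1 e) / 2) e" using lt(1) unfolding B_def by blast
      then show ?thesis unfolding t_def using nP True by simp
    qed
  qed
  ultimately show ?thesis by blast
qed

text \<open>A fibre without nonnegative elements is reflected at 0 to bring it under
  \<open>choice_nonneg\<close>.\<close>

lemma choice:
  assumes P: "dpred (\<lambda>e. P (e 0) (\<lambda>i. e (Suc i)))"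
  shows "\<exists>t. dterm t \<and> (\<forall>e. (\<exists>y. P y e) \<longrightarrow> P (t e) e)"
proof -
  have Pd [def_intros]: "dpred (\<lambda>e. P (s e) (X e))" if "\<And>i. dterm (\<lambda>e. X e i)" "dterm s" for X s
    using dpred_app[where R = "\<lambda>x y. P y x", OF P that] .
  define Q where "Q y e \<longleftrightarrow> P y e \<and> 0 \<le> y" for y e
  define Q' where "Q' y e \<longleftrightarrow> P (0 - y) e \<and> 0 \<le> y" for y e
  have Qd: "dpred (\<lambda>e. Q (e 0) (\<lambda>i. e (Suc i)))" unfolding Q_def by (intro def_intros)
  obtain t where t: "dterm t" "\<And>e y. Q y e \<Longrightarrow> Q (t e) e"
  proof -
    have "\<exists>t. dterm t \<and> (\<forall>e. (\<exists>y. Q y e) \<longrightarrow> Q (t e) e)"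
      by (rule choice_nonneg[of Q, OF Qd]) (simp add: Q_def)
    then show ?thesis using that by blast
  qed
  have Qd': "dpred (\<lambda>e. Q' (e 0) (\<lambda>i. e (Suc i)))" unfolding Q'_def by (intro def_intros)
  obtain t' where t': "dterm t'" "\<And>e y. Q' y e \<Longrightarrow> Q' (t' e) e"
  proof -
    have "\<exists>t. dterm t \<and> (\<forall>e. (\<exists>y. Q' y e) \<longrightarrow> Q' (t e) e)"
      by (rule choice_nonneg[of Q', OF Qd']) (simp add: Q'_def)
    then show ?thesis using that by blast
  qed
  have "dterm (\<lambda>e. if Q (t e) e then t e else 0 - t' e)"
    unfolding Q_def by (intro def_intros t(1) t'(1))
  moreover have "P (if Q (t e) e then t e else 0 - t' e) e" if "P y e" for y e
  proof (cases "0 \<le> y")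
    case True
    then have "Q (t e) e" using t(2)[of y e] that unfolding Q_def by blast
    then show ?thesis unfolding Q_def by simp
  next
    case False
    then have "Q' (t' e) e" using t'(2)[of "- y" e] that unfolding Q'_def by simp
    then show ?thesis unfolding Q_def Q'_def by simp
  qed
  ultimately show ?thesis by blast
qed

lemma dpred_app_tup:
  assumes P: "dpred (\<lambda>e. P (restrict e {..<n}) (\<lambda>i. e (i + n)))"
    and X: "\<And>i. i < n \<Longrightarrow> dterm (\<lambda>e. X e i)" "\<And>e. X e \<in> Mn n" and Y: "\<And>i. dterm (\<lambda>e. Y e i)"
  shows "dpred (\<lambda>e. P (X e) (Y e))"
proof -
  let ?T = "\<lambda>e i. if i < n then X e i else Y e (i - n)"
  have "dterm (\<lambda>e. ?T e i)" for i using X Y by (cases "i < n") auto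
  from dpred_subst[OF P, where T = ?T, OF this]
  have "dpred (\<lambda>e. P (restrict (?T e) {..<n}) (\<lambda>i. ?T e (i + n)))" .
  moreover have "restrict (?T e) {..<n} = X e" "(\<lambda>i. ?T e (i + n)) = Y e" for e
    using X(2)[of e] by (auto simp: Mn_def PiE_iff extensional_def fun_eq_iff)
  ultimately show ?thesis by (simp only:)
qed

text \<open>T picks the first n coordinates so that a last one still exists; the last coordinate is
  then chosen with T as its parameter.\<close>

lemma choice_tup:
  assumes "dpred (\<lambda>e. P (restrict e {..<n}) (\<lambda>i. e (i + n)))"
  shows "\<exists>T. (\<forall>i<n. dterm (\<lambda>e. T e i)) \<and> (\<forall>e. T e \<in> Mn n) \<and> (\<forall>e. (\<exists>y\<in>Mn n. P y e) \<longrightarrow> P (T e) e)"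
  using assms
proof (induction n arbitrary: P)
  case 0
  then show ?case by (intro exI[of _ "\<lambda>e i. undefined"]) (auto simp: Mn_def)
next
  case (Suc n)
  have Pd: "dpred (\<lambda>e. P ((X e)(n := t e)) (Y e))"
    if "\<And>i. i < n \<Longrightarrow> dterm (\<lambda>e. X e i)" "\<And>e. X e \<in> Mn n" "dterm t" "\<And>i. dterm (\<lambda>e. Y e i)" for X Y t
  proof (rule dpred_app_tup[of P "Suc n", OF Suc.prems])
    show "dterm (\<lambda>e. ((X e)(n := t e)) i)" if "i < Suc n" for i
      using that \<open>dterm t\<close> \<open>\<And>i. i < n \<Longrightarrow> dterm (\<lambda>e. X e i)\<close> by (cases "i = n") auto
    show "(X e)(n := t e) \<in> Mn (Suc n)" for e
      using \<open>X e \<in> Mn n\<close> by (auto simp: Mn_def PiE_iff extensional_def)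
  qed (rule that(4))
  have "dpred (\<lambda>e. P ((restrict (\<lambda>i. e (Suc i)) {..<n})(n := e 0)) (\<lambda>i. e (Suc (i + n))))"
    by (rule Pd) (auto intro!: def_intros simp: Mn_def)
  then have "dpred (\<lambda>e. \<exists>v. P ((restrict e {..<n})(n := v)) (\<lambda>i. e (i + n)))" by (intro dpred_ex)
  from Suc.IH[of "\<lambda>y e. \<exists>v. P (y(n := v)) e", OF this]
  obtain T where T: "\<And>i. i < n \<Longrightarrow> dterm (\<lambda>e. T e i)" "\<And>e. T e \<in> Mn n"
    "\<And>e. \<exists>y\<in>Mn n. \<exists>v. P (y(n := v)) e \<Longrightarrow> \<exists>v. P ((T e)(n := v)) e" by blast
  have "dpred (\<lambda>e. P ((T (\<lambda>i. e (Suc i)))(n := e 0)) (\<lambda>i. e (Suc i)))"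
    using T(2) by (intro Pd dterm_rename[OF T(1)] dterm_var)
  from choice[of "\<lambda>v e. P ((T e)(n := v)) e", OF this]
  obtain t where t: "dterm t" "\<And>e. \<exists>v. P ((T e)(n := v)) e \<Longrightarrow> P ((T e)(n := t e)) e" by blast
  show ?case
  proof (intro exI[of _ "\<lambda>e. (T e)(n := t e)"] conjI allI impI)
    show "dterm (\<lambda>e. ((T e)(n := t e)) i)" if "i < Suc n" for i
      using that t(1) T(1) by (cases "i = n") auto
    show "(T e)(n := t e) \<in> Mn (Suc n)" for e
      using T(2)[of e] by (auto simp: Mn_def PiE_iff extensional_def)
    show "P ((T e)(n := t e)) e" if "\<exists>y\<in>Mn (Suc n). P y e" for e
      using that t(2) T(3) unfolding Mn_Suc_iff by blast
  qed
qed

end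

section \<open>Definable maps: coordinate terms, composition, sections\<close>

lemma tjoin_Mn: "tjoin k m x y \<in> Mn (k + m)"
  unfolding tjoin_def Mn_def by (auto simp: PiE_iff extensional_def)

lemma tjoin_eq_iff:
  assumes "x \<in> Mn k" "x' \<in> Mn k" "y \<in> Mn m" "y' \<in> Mn m"
  shows "tjoin k m x y = tjoin k m x' y' \<longleftrightarrow> x = x' \<and> y = y'"
proof
  assume eq: "tjoin k m x y = tjoin k m x' y'"
  have "x i = x' i" for i
    using fun_cong[OF eq, of i] assms(1,2)
    by (cases "i < k") (auto simp: tjoin_def Mn_def PiE_iff extensional_def)
  moreover have "y i = y' i" for i
    using fun_cong[OF eq, of "k + i"] assms(3,4)
    by (cases "i < m") (auto simp: tjoin_def Mn_def PiE_iff extensional_def)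
  ultimately show "x = x' \<and> y = y'" by auto
qed auto

lemma restrict_Mn: "x \<in> Mn n \<Longrightarrow> restrict x {..<n} = x"
  unfolding Mn_def by (rule PiE_restrict)

lemma restrict_in_Mn: "restrict x {..<n} \<in> Mn n"
  unfolding Mn_def by auto

context omin_field
begin

lemma def_map_in: "def_map S k m X f \<Longrightarrow> x \<in> X \<Longrightarrow> x \<in> Mn k"
  and def_map_val: "def_map S k m X f \<Longrightarrow> x \<in> X \<Longrightarrow> f x \<in> Mn m"
  and def_map_dom: "def_map S k m X f \<Longrightarrow> X \<in> S k"
  unfolding def_map_def using S_sub by auto

lemma dpred_graph:
  assumes f: "def_map S k m X f"
    and x: "\<And>i. i < k \<Longrightarrow> dterm (\<lambda>e. x e i)" "\<And>e. x e \<in> Mn k"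
    and y: "\<And>i. i < m \<Longrightarrow> dterm (\<lambda>e. y e i)" "\<And>e. y e \<in> Mn m"
  shows "dpred (\<lambda>e. x e \<in> X \<and> y e = f (x e))"
proof -
  let ?\<Gamma> = "{tjoin k m x (f x) | x. x \<in> X}"
  have "dpred (\<lambda>e. tjoin k m (x e) (y e) \<in> ?\<Gamma>)"
  proof (rule dpred_mem)
    show "?\<Gamma> \<in> S (k + m)" using f unfolding def_map_def by auto
    show "dterm (\<lambda>e. tjoin k m (x e) (y e) i)" if "i < k + m" for i
      using x y that by (cases "i < k") (auto simp: tjoin_def)
  qed (rule tjoin_Mn)
  moreover have "tjoin k m (x e) (y e) \<in> ?\<Gamma> \<longleftrightarrow> x e \<in> X \<and> y e = f (x e)" for e
    using tjoin_eq_iff[OF x(2)[of e] _ y(2)[of e]] def_map_in[OF f] def_map_val[OF f] by blast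
  ultimately show ?thesis by simp
qed

text \<open>Terms are functions on all environments, so a coordinate of a map given only on X needs
  a default value outside X.\<close>

definition total :: "nat \<Rightarrow> 'a tup set \<Rightarrow> ('a tup \<Rightarrow> 'a tup) \<Rightarrow> nat \<Rightarrow> 'a tup \<Rightarrow> 'a" where
  "total k X f i e = (if restrict e {..<k} \<in> X then f (restrict e {..<k}) i else 0)"

lemma restrict_total:
  assumes f: "def_map S k m X f" and x: "x \<in> X"
  shows "restrict (\<lambda>i. total k X f i x) {..<m} = f x"
proof -
  have "restrict x {..<k} = x" using restrict_Mn[OF def_map_in[OF f x]] .
  then have "(\<lambda>i. total k X f i x) = f x" using x unfolding total_def by simp
  then show ?thesis using restrict_Mn[OF def_map_val[OF f x]] by (simp only:)
qed

lemma dpred_dom: "X \<in> S k \<Longrightarrow> dpred (\<lambda>e. restrict e {..<k} \<in> X)"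
  by (rule dpred_mem) (auto intro!: def_intros simp: restrict_in_Mn)

lemma dterm_total:
  assumes f: "def_map S k m X f" and i: "i < m"
  shows "dterm (total k X f i)"
proof -
  have "dpred (\<lambda>e. \<exists>y\<in>Mn m. (restrict (\<lambda>i. e (Suc i)) {..<k} \<in> X \<and> y = f (restrict (\<lambda>i. e (Suc i)) {..<k})) \<and> e 0 = y i)"
  proof (rule dpred_ex_tup, rule dpred_conj)
    show "dpred (\<lambda>e. restrict (\<lambda>i. e (Suc i + m)) {..<k} \<in> X \<and>
        restrict e {..<m} = f (restrict (\<lambda>i. e (Suc i + m)) {..<k}))"
      by (rule dpred_graph[OF f]) (auto intro!: def_intros simp: restrict_in_Mn)
  qed (intro def_intros)
  moreover have "dpred (\<lambda>e. \<not> restrict (\<lambda>i. e (Suc i)) {..<k} \<in> X \<and> e 0 = 0)"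
    using dpred_rename[OF dpred_dom[OF def_map_dom[OF f]], of Suc] by (intro def_intros)
  ultimately have "dpred (\<lambda>e. (\<exists>y\<in>Mn m. (restrict (\<lambda>i. e (Suc i)) {..<k} \<in> X
      \<and> y = f (restrict (\<lambda>i. e (Suc i)) {..<k})) \<and> e 0 = y i)
      \<or> (\<not> restrict (\<lambda>i. e (Suc i)) {..<k} \<in> X \<and> e 0 = 0))" by (rule dpred_disj)
  then show ?thesis unfolding dterm_def
    by (rule back_subst[of dpred]) (auto simp: total_def def_map_val[OF f] fun_eq_iff)
qed

text \<open>Counterpart of \<open>dterm_total\<close>: with both, one passes freely between graphs
  and coordinate terms, and composition becomes substitution.\<close>

lemma def_mapI:
  assumes X: "X \<in> S k" and f: "\<And>x. x \<in> X \<Longrightarrow> f x \<in> Mn m"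
    and t: "\<And>i. i < m \<Longrightarrow> dterm (t i)" "\<And>x i. x \<in> X \<Longrightarrow> i < m \<Longrightarrow> f x i = t i x"
  shows "def_map S k m X f"
  unfolding def_map_def
proof (intro conjI X)
  show "f ` X \<subseteq> Mn m" using f by auto
  let ?P = "\<lambda>e. restrict e {..<k} \<in> X \<and> (\<forall>i<m. e (k + i) = t i (restrict e {..<k}))"
  show "{tjoin k m x (f x) |x. x \<in> X} \<in> S (k + m)"
  proof (rule dpred_imp_S)
    show "dpred ?P"
      by (intro def_intros dpred_dom[OF X] dterm_restrict_shift t(1))
    fix z
    show "z \<in> {tjoin k m x (f x) |x. x \<in> X} \<longleftrightarrow> z \<in> Mn (k + m) \<and> ?P z"
    proof
      assume "z \<in> {tjoin k m x (f x) |x. x \<in> X}"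
      then obtain x where x: "x \<in> X" "z = tjoin k m x (f x)" by auto
      have "x \<in> Mn k" using x(1) S_sub[OF X] by auto
      then have "restrict z {..<k} = x"
        unfolding x(2) tjoin_def by (auto simp: Mn_def PiE_iff extensional_def fun_eq_iff)
      moreover have "z (k + i) = f x i" if "i < m" for i using that unfolding x(2) tjoin_def by simp
      ultimately show "z \<in> Mn (k + m) \<and> ?P z" using x t(2) tjoin_Mn by auto
    next
      assume z: "z \<in> Mn (k + m) \<and> ?P z"
      have "z j = tjoin k m (restrict z {..<k}) (f (restrict z {..<k})) j" for j
      proof (cases "k \<le> j \<and> j < k + m")
        case True
        then obtain i where "j = k + i" "i < m" by (auto simp: le_iff_add)
        then show ?thesis using z t(2)[of "restrict z {..<k}" i] by (simp add: tjoin_def)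
      qed (use z in \<open>auto simp: tjoin_def Mn_def PiE_iff extensional_def\<close>)
      then have "z = tjoin k m (restrict z {..<k}) (f (restrict z {..<k}))" by blast
      then show "z \<in> {tjoin k m x (f x) |x. x \<in> X}" using z by blast
    qed
  qed
qed

lemma def_map_preimage:
  assumes f: "def_map S k m X f" and Y: "Y \<in> S m"
  shows "{x \<in> X. f x \<in> Y} \<in> S k"
proof (rule dpred_imp_S)
  let ?F = "\<lambda>e. restrict (\<lambda>i. total k X f i e) {..<m}"
  have "dpred (\<lambda>e. ?F e \<in> Y)"
    by (rule dpred_mem[OF Y]) (auto simp: restrict_in_Mn dterm_total[OF f])
  then show "dpred (\<lambda>e. restrict e {..<k} \<in> X \<and> ?F e \<in> Y)"
    by (intro dpred_conj dpred_dom[OF def_map_dom[OF f]])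
  show "x \<in> {x \<in> X. f x \<in> Y} \<longleftrightarrow> x \<in> Mn k \<and> restrict x {..<k} \<in> X \<and> ?F x \<in> Y" for x
    using def_map_in[OF f] restrict_Mn[of x k] restrict_total[OF f, of x]
    by (metis (no_types, lifting) mem_Collect_eq)
qed

lemma def_map_comp:
  assumes f: "def_map S k m X f" and g: "def_map S m p Y g"
  shows "def_map S k p {x \<in> X. f x \<in> Y} (\<lambda>x. g (f x))"
proof (rule def_mapI)
  let ?F = "\<lambda>e. restrict (\<lambda>i. total k X f i e) {..<m}"
  show "{x \<in> X. f x \<in> Y} \<in> S k" using def_map_preimage[OF f def_map_dom[OF g]] .
  show "g (f x) \<in> Mn p" if "x \<in> {x \<in> X. f x \<in> Y}" for x using that def_map_val[OF g] by auto
  show "dterm (\<lambda>e. total m Y g i (?F e))" if "i < p" for i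
  proof (rule dterm_subst[OF dterm_total[OF g that], of ?F])
    show "dterm (\<lambda>e. ?F e j)" for j
      using dterm_total[OF f, of j] dterm_const by (cases "j < m") auto
  qed
  show "g (f x) i = total m Y g i (?F x)" if "x \<in> {x \<in> X. f x \<in> Y}" "i < p" for x i
  proof -
    have F: "?F x = f x" using restrict_total[OF f] that by blast
    have "restrict (f x) {..<m} = f x" using restrict_Mn[OF def_map_val[OF f]] that by auto
    then show ?thesis using that unfolding F by (auto simp: total_def)
  qed
qed

text \<open>Definable choice in the fibres of f. For a chart, which is injective, the section is the
  inverse; for \<iota> it picks a representative of each coset.\<close>

lemma def_map_section:
  assumes f: "def_map S k m X f"
  shows "\<exists>s. def_map S m k (f ` X) s \<and> (\<forall>y\<in>f ` X. s y \<in> X \<and> f (s y) = y)"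
proof -
  define P where "P x e \<longleftrightarrow> x \<in> X \<and> restrict e {..<m} = f x" for x e
  have Pd: "dpred (\<lambda>e. P (restrict e {..<k}) (\<lambda>i. e (i + k)))"
    unfolding P_def by (rule dpred_graph[OF f]) (auto intro!: def_intros simp: restrict_in_Mn)
  from choice_tup[of P k, OF this]
  obtain T where T: "\<And>i. i < k \<Longrightarrow> dterm (\<lambda>e. T e i)" "\<And>e. T e \<in> Mn k"
    "\<And>e. \<exists>x\<in>Mn k. P x e \<Longrightarrow> P (T e) e" by blast
  have "f ` X \<in> S m"
  proof (rule dpred_imp_S)
    show "dpred (\<lambda>e. \<exists>x\<in>Mn k. P x e)" using Pd by (rule dpred_ex_tup)
    show "y \<in> f ` X \<longleftrightarrow> y \<in> Mn m \<and> (\<exists>x\<in>Mn k. P x y)" for y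
      unfolding P_def using def_map_in[OF f] def_map_val[OF f] restrict_Mn by fastforce
  qed
  then have "def_map S m k (f ` X) T"
    by (rule def_mapI[where t = "\<lambda>i e. T e i"]) (use T in auto)
  moreover have "T y \<in> X \<and> f (T y) = y" if "y \<in> f ` X" for y
  proof -
    have y: "restrict y {..<m} = y" using that def_map_val[OF f] restrict_Mn by auto
    then have "\<exists>x\<in>Mn k. P x y" using that def_map_in[OF f] unfolding P_def by auto
    then show ?thesis using T(3)[of y] y unfolding P_def by auto
  qed
  ultimately show ?thesis by blast
qed

end

section \<open>Continuity points of definable maps between manifolds\<close>

lemma openin_obox: "openin (Mtop n) (obox n a b)"
  unfolding openin_Mtop open_box_def
proof (intro conjI ballI)
  show "obox n a b \<subseteq> Mn n" unfolding obox_def by auto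
  fix x assume "x \<in> obox n a b"
  then show "\<exists>a' b'. (\<forall>i<n. a' i < x i \<and> x i < b' i) \<and> {y \<in> Mn n. \<forall>i<n. a' i < y i \<and> y i < b' i} \<subseteq> obox n a b"
    unfolding obox_def by (intro exI[of _ a] exI[of _ b]) auto
qed

lemma openin_Mtop_obox:
  assumes "openin (Mtop n) U" "x \<in> U"
  shows "\<exists>a b. x \<in> obox n a b \<and> obox n a b \<subseteq> U"
proof -
  have "x \<in> Mn n" using assms unfolding openin_Mtop open_box_def by auto
  then show ?thesis using assms unfolding openin_Mtop open_box_def obox_def by blast
qed

lemma cts_at_many:
  fixes f :: "nat \<Rightarrow> 'a::linordered_field tup \<Rightarrow> 'a"
  assumes "\<forall>j<d. cts_at n (f j) x" and "\<forall>j<d. a j < f j x \<and> f j x < b j"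
  shows "\<exists>\<epsilon>>0. \<forall>y\<in>Mn n. near n \<epsilon> x y \<longrightarrow> (\<forall>j<d. a j < f j y \<and> f j y < b j)"
proof -
  have "\<exists>\<epsilon>>0. \<forall>y\<in>Mn n. near n \<epsilon> x y \<longrightarrow> a j < f j y \<and> f j y < b j" if j: "j < d" for j
  proof -
    let ?\<delta> = "min (f j x - a j) (b j - f j x)"
    have "0 < ?\<delta>" using assms(2) j by simp
    then obtain \<epsilon> where "\<epsilon> > 0" and \<epsilon>: "\<forall>y\<in>Mn n. near n \<epsilon> x y \<longrightarrow> f j x - ?\<delta> < f j y \<and> f j y < f j x + ?\<delta>"
      using assms(1) j unfolding cts_at_def by blast
    have "a j < f j y \<and> f j y < b j" if "y \<in> Mn n" "near n \<epsilon> x y" for y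
    proof -
      have "f j x - ?\<delta> < f j y" "f j y < f j x + ?\<delta>" using \<epsilon> that by auto
      moreover have "?\<delta> \<le> f j x - a j" "?\<delta> \<le> b j - f j x" by auto
      ultimately show ?thesis by linarith
    qed
    with \<open>\<epsilon> > 0\<close> show ?thesis by blast
  qed
  then obtain \<epsilon> where \<epsilon>: "\<And>j. j < d \<Longrightarrow> 0 < \<epsilon> j"
    "\<And>j y. j < d \<Longrightarrow> y \<in> Mn n \<Longrightarrow> near n (\<epsilon> j) x y \<Longrightarrow> a j < f j y \<and> f j y < b j" by metis
  obtain \<epsilon>0 where "\<epsilon>0 > 0" "\<forall>j<d. \<epsilon>0 \<le> \<epsilon> j" using uniform_positive[of d \<epsilon>] \<epsilon>(1) by blast
  then show ?thesis using \<epsilon>(2) near_mono by (intro exI[of _ \<epsilon>0]) blast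
qed

context omin_field
begin

text \<open>In charts f becomes a map from part of \<open>M^n\<close> to \<open>M^p\<close>, defined
  where its values lie in one fixed chart of Y. The lemmas on boxes give a subbox sent into a single
  chart, and inside it a subbox where all coordinates are continuous; the charts carry continuity
  back to the manifolds.\<close>

lemma def_map_continuity_point:
  assumes X: "def_manifold S k n X T" and Y: "def_manifold S m p Y T'"
    and f: "def_map S k m X f" and fXY: "f ` X \<subseteq> Y" and ne: "X \<noteq> {}"
  shows "\<exists>x0\<in>X. \<forall>V. openin T' V \<and> f x0 \<in> V \<longrightarrow> (\<exists>W. openin T W \<and> x0 \<in> W \<and> f ` W \<subseteq> V)"
proof -
  obtain F \<phi> where F: "\<Union>F = X" and charts: "\<And>U. U \<in> F \<Longrightarrow> openin T U \<and> def_map S k n U (\<phi> U) \<and>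
      openin (Mtop n) (\<phi> U ` U) \<and>
      homeomorphic_map (subtopology T U) (subtopology (Mtop n) (\<phi> U ` U)) (\<phi> U)"
    using X unfolding def_manifold_def by blast
  obtain F' \<phi>' where F': "finite F'" "\<Union>F' = Y" and charts': "\<And>U. U \<in> F' \<Longrightarrow> openin T' U \<and>
      def_map S m p U (\<phi>' U) \<and> openin (Mtop p) (\<phi>' U ` U) \<and>
      homeomorphic_map (subtopology T' U) (subtopology (Mtop p) (\<phi>' U ` U)) (\<phi>' U)"
    using Y unfolding def_manifold_def by blast
  obtain U where U: "U \<in> F" "U \<noteq> {}" using F ne by auto
  define \<alpha> where "\<alpha> = \<phi> U"
  define O' where "O' = \<alpha> ` U"
  have \<alpha>: "openin T U" "def_map S k n U \<alpha>" "openin (Mtop n) O'"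
    "homeomorphic_map (subtopology T U) (subtopology (Mtop n) O') \<alpha>"
    using charts[OF U(1)] unfolding O'_def \<alpha>_def by auto
  have tU: "topspace (subtopology T U) = U" using openin_subset[OF \<alpha>(1)] by auto
  have inj\<alpha>: "inj_on \<alpha> U" using homeomorphic_imp_injective_map[OF \<alpha>(4)] unfolding tU .
  \<comment> \<open>A section of the injective chart \<alpha> is its inverse, and it is definable on
    all of \<open>O'\<close>.\<close>
  obtain \<psi> where \<psi>: "def_map S n k O' \<psi>" "\<And>y. y \<in> O' \<Longrightarrow> \<psi> y \<in> U \<and> \<alpha> (\<psi> y) = y"
    using def_map_section[OF \<alpha>(2)] unfolding O'_def by blast
  have \<psi>\<alpha>: "\<psi> (\<alpha> u) = u" if "u \<in> U" for u
    using \<psi>(2)[of "\<alpha> u"] inj\<alpha> that unfolding O'_def inj_on_def by blast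
  define g where "g y = f (\<psi> y)" for y
  have \<psi>X: "\<psi> y \<in> X" if "y \<in> O'" for y using \<psi>(2)[OF that] U F by auto
  have g: "def_map S n m O' g"
  proof -
    have "{y \<in> O'. \<psi> y \<in> X} = O'" using \<psi>X by auto
    then show ?thesis using def_map_comp[OF \<psi>(1) f] unfolding g_def by simp
  qed
  obtain a b where ab: "\<And>i. i < n \<Longrightarrow> a i < b i" "obox n a b \<subseteq> O'"
  proof -
    obtain x where "x \<in> O'" using U(2) unfolding O'_def by auto
    then obtain a b where "x \<in> obox n a b" "obox n a b \<subseteq> O'" using openin_Mtop_obox[OF \<alpha>(3)] by blast
    moreover from this have "a i < b i" if "i < n" for i
      using that unfolding obox_def by (auto intro: order.strict_trans)
    ultimately show ?thesis using that by blast
  qed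
  have rx: "restrict x {..<n} = x" if "x \<in> obox n a b" for x a b
    using that restrict_Mn unfolding obox_def by blast
  \<comment> \<open>The box is covered by the preimages of finitely many charts of Y, so one
    preimage contains a subbox.\<close>
  have "\<exists>V\<in>F'. \<exists>a' b'. subbox n a b a' b' \<and> (\<forall>x\<in>obox n a' b'. restrict x {..<n} \<in> {y \<in> O'. g y \<in> V})"
  proof (rule finite_cover_subbox[OF F'(1)])
    show "dpred (\<lambda>x. restrict x {..<n} \<in> {y \<in> O'. g y \<in> V})" if "V \<in> F'" for V
      using def_map_preimage[OF g] def_map_dom charts'[OF that] by (intro dpred_dom) blast
    show "\<exists>V\<in>F'. restrict x {..<n} \<in> {y \<in> O'. g y \<in> V}" if "x \<in> obox n a b" for x
    proof -
      have "x \<in> O'" using that ab(2) by auto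
      then have "g x \<in> Y" using \<psi>X fXY unfolding g_def by auto
      then show ?thesis using \<open>x \<in> O'\<close> F'(2) rx[OF that] by auto
    qed
  qed (rule ab(1))
  then obtain V' a1 b1 where V': "V' \<in> F'" and 1: "subbox n a b a1 b1"
    "\<And>x. x \<in> obox n a1 b1 \<Longrightarrow> x \<in> O' \<and> g x \<in> V'"
    using rx by fastforce
  define \<beta> where "\<beta> = \<phi>' V'"
  define A where "A = {y \<in> O'. g y \<in> V'}"
  define h where "h y = \<beta> (g y)" for y
  have \<beta>: "openin T' V'" "def_map S m p V' \<beta>" "openin (Mtop p) (\<beta> ` V')"
    "homeomorphic_map (subtopology T' V') (subtopology (Mtop p) (\<beta> ` V')) \<beta>"
    using charts'[OF V'] unfolding \<beta>_def by auto
  have tV: "topspace (subtopology T' V') = V'" using openin_subset[OF \<beta>(1)] by auto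
  have inj\<beta>: "inj_on \<beta> V'" using homeomorphic_imp_injective_map[OF \<beta>(4)] unfolding tV .
  have h: "def_map S n p A h" using def_map_comp[OF g \<beta>(2)] unfolding A_def h_def .
  obtain a2 b2 where 2: "subbox n a1 b1 a2 b2"
    "\<And>x. x \<in> obox n a2 b2 \<Longrightarrow> \<forall>j<p. cts_at n (total n A h j) x"
    using continuous_subbox_many[of p "total n A h" n a1 b1] dterm_total[OF h] subbox_less[OF 1(1)] by blast
  obtain x1 where x1: "x1 \<in> obox n a2 b2" using obox_nonempty[of n a2 b2] subbox_less[OF 2(1)] by blast
  have inA: "x \<in> A" if "x \<in> obox n a2 b2" for x
    using 1(2)[OF obox_mono[OF 2(1) that]] unfolding A_def by auto
  have tot: "total n A h j x = h x j" if "x \<in> obox n a2 b2" for x j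
    using rx[OF that] inA[OF that] unfolding total_def by simp
  have x1O: "x1 \<in> O'" using inA[OF x1] unfolding A_def by auto
  show ?thesis
  proof (intro bexI allI impI)
    show "\<psi> x1 \<in> X" using \<psi>X x1O .
    fix V assume V: "openin T' V \<and> f (\<psi> x1) \<in> V"
    \<comment> \<open>Only the part of V inside the chart domain is visible in coordinates; its
      image is open in \<open>M^p\<close> because the image of the whole chart is.\<close>
    have "openin (subtopology T' V') (V \<inter> V')" using V by (auto simp: openin_subtopology)
    then have "openin (subtopology (Mtop p) (\<beta> ` V')) (\<beta> ` (V \<inter> V'))"
      using homeomorphic_imp_open_map[OF \<beta>(4)] unfolding open_map_def by blast
    then have "openin (Mtop p) (\<beta> ` (V \<inter> V'))" using \<beta>(3) openin_open_subtopology by blast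
    moreover have "h x1 \<in> \<beta> ` (V \<inter> V')"
      using V inA[OF x1] unfolding h_def A_def g_def by auto
    ultimately obtain a' b' where ab': "h x1 \<in> obox p a' b'" "obox p a' b' \<subseteq> \<beta> ` (V \<inter> V')"
      using openin_Mtop_obox by blast
    have "\<forall>j<p. a' j < total n A h j x1 \<and> total n A h j x1 < b' j"
      using ab'(1) unfolding tot[OF x1] obox_def by auto
    from cts_at_many[OF 2(2)[OF x1] this] obtain \<epsilon>1 where \<epsilon>1: "\<epsilon>1 > 0"
      "\<And>y. y \<in> Mn n \<Longrightarrow> near n \<epsilon>1 x1 y \<Longrightarrow> \<forall>j<p. a' j < total n A h j y \<and> total n A h j y < b' j" by blast
    obtain \<epsilon>2 where \<epsilon>2: "\<epsilon>2 > 0" "\<And>y. y \<in> Mn n \<Longrightarrow> near n \<epsilon>2 x1 y \<Longrightarrow> y \<in> obox n a2 b2"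
      using near_obox[OF x1] by blast
    define \<epsilon> where "\<epsilon> = min \<epsilon>1 \<epsilon>2"
    \<comment> \<open>A cube about x1, small enough to stay in the box where h is defined and to
      keep h inside \<open>obox p a' b'\<close>.\<close>
    define N where "N = obox n (\<lambda>i. x1 i - \<epsilon>) (\<lambda>i. x1 i + \<epsilon>)"
    have "\<epsilon> > 0" using \<epsilon>1 \<epsilon>2 unfolding \<epsilon>_def by auto
    have N: "y \<in> obox n a2 b2 \<and> g y \<in> V" if "y \<in> N" for y
    proof -
      have y: "y \<in> Mn n" "near n \<epsilon> x1 y" using that unfolding N_def obox_def near_def by auto
      then have "near n \<epsilon>1 x1 y" "near n \<epsilon>2 x1 y" using near_mono unfolding \<epsilon>_def by (meson min.cobounded1 min.cobounded2)+
      then have yb: "y \<in> obox n a2 b2" and "\<forall>j<p. a' j < total n A h j y \<and> total n A h j y < b' j"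
        using \<epsilon>1 \<epsilon>2 y by auto
      then have "h y \<in> obox p a' b'"
        using tot[OF yb] def_map_val[OF h inA[OF yb]] unfolding obox_def by auto
      then obtain v where "v \<in> V \<inter> V'" "\<beta> (g y) = \<beta> v" using ab'(2) unfolding h_def by auto
      moreover have "g y \<in> V'" using inA[OF yb] unfolding A_def by auto
      ultimately show ?thesis using yb inj\<beta> unfolding inj_on_def by auto
    qed
    define W where "W = {u \<in> U. \<alpha> u \<in> N}"
    have "N \<subseteq> O'" using N inA unfolding A_def by auto
    moreover have "openin (Mtop n) N" unfolding N_def by (rule openin_obox)
    ultimately have "openin (subtopology (Mtop n) O') N" using \<alpha>(3) openin_open_subtopology by blast
    then have "openin (subtopology T U) {u \<in> topspace (subtopology T U). \<alpha> u \<in> N}"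
      using homeomorphic_imp_continuous_map[OF \<alpha>(4)] openin_continuous_map_preimage by blast
    then have "openin T W" unfolding tU W_def using \<alpha>(1) openin_open_subtopology by blast
    moreover have "\<psi> x1 \<in> W"
    proof -
      have "x1 \<in> N" using x1 \<open>\<epsilon> > 0\<close> unfolding N_def obox_def by auto
      then show ?thesis unfolding W_def using \<psi>(2)[OF x1O] by auto
    qed
    moreover have "f ` W \<subseteq> V"
      using N \<psi>\<alpha> unfolding W_def g_def by force
    ultimately show "\<exists>W. openin T W \<and> \<psi> x1 \<in> W \<and> f ` W \<subseteq> V" by blast
  qed
qed

end

section \<open>Topologies on the coset space\<close>

locale coset_map = group G + subgroup H G for G :: "'a monoid" (structure) and H +
  fixes \<iota> :: "'a \<Rightarrow> 'b"
  assumes \<iota>_eq_iff: "g \<in> carrier G \<Longrightarrow> h \<in> carrier G \<Longrightarrow> \<iota> g = \<iota> h \<longleftrightarrow> g <# H = h <# H"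
begin

abbreviation rep :: "'b \<Rightarrow> 'a" where
  "rep \<equiv> inv_into (carrier G) \<iota>"

lemma rep: "g \<in> carrier G \<Longrightarrow> rep (\<iota> g) \<in> carrier G \<and> \<iota> (rep (\<iota> g)) = \<iota> g"
  by (simp add: inv_into_into f_inv_into_f)

text \<open>Left translation permutes left cosets, so the action on \<open>G/H\<close> is
  independent of representatives.\<close>

lemma \<iota>_mult_left:
  assumes "g \<in> carrier G" "a \<in> carrier G" "b \<in> carrier G" "\<iota> a = \<iota> b"
  shows "\<iota> (g \<otimes> a) = \<iota> (g \<otimes> b)"
proof -
  have "(g \<otimes> a) <# H = g <# (a <# H)" "(g \<otimes> b) <# H = g <# (b <# H)"
    using lcos_m_assoc[OF subset] assms by auto
  moreover have "a <# H = b <# H" using assms \<iota>_eq_iff by blast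
  ultimately show ?thesis using assms \<iota>_eq_iff by auto
qed

lemma \<iota>_mult_rep:
  assumes "g \<in> carrier G" "a \<in> carrier G"
  shows "\<iota> (g \<otimes> rep (\<iota> a)) = \<iota> (g \<otimes> a)"
  using \<iota>_mult_left[of g "rep (\<iota> a)" a] rep[of a] assms by blast

text \<open>For normal H the product of two left cosets is the left coset of the product, so the
  representatives taken by \<open>rep\<close> may be replaced by any others.\<close>

lemma \<iota>_mult_quot:
  assumes "H \<lhd> G" "a \<in> carrier G" "b \<in> carrier G"
  shows "\<iota> a \<otimes>\<^bsub>quot_group G \<iota>\<^esub> \<iota> b = \<iota> (a \<otimes> b)"
proof -
  interpret N: normal H G by fact
  have *: "(x \<otimes> y) <# H = (x <# H) <#> (y <# H)" if "x \<in> carrier G" "y \<in> carrier G" for x y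
    using N.rcos_sum[OF that] N.coset_eq that by simp
  have "rep (\<iota> a) <# H = a <# H" "rep (\<iota> b) <# H = b <# H"
    using rep \<iota>_eq_iff assms by blast+
  then have "(rep (\<iota> a) \<otimes> rep (\<iota> b)) <# H = (a \<otimes> b) <# H"
    using * rep assms by simp
  then show ?thesis unfolding quot_group_def using rep \<iota>_eq_iff assms by simp
qed

end

section \<open>Openness and continuity of the coset map by translation\<close>

lemma continuous_map_left_mult:
  assumes "is_topgroup T (\<lambda>x y. x \<otimes>\<^bsub>G\<^esub> y) i" "g \<in> topspace T"
  shows "continuous_map T T (\<lambda>x. g \<otimes>\<^bsub>G\<^esub> x)"
proof -
  have "continuous_map T (prod_topology T T) (\<lambda>x. (g, x))"
    using assms(2) by (intro continuous_map_pairedI) auto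
  from continuous_map_compose[OF this, of T "\<lambda>(x, y). x \<otimes>\<^bsub>G\<^esub> y"] assms(1) show ?thesis
    unfolding is_topgroup_def by (simp add: o_def)
qed

context omin_field
begin

lemma quotient_topology_unique:
  fixes G :: "'a tup monoid" (structure)
  assumes GT: "def_group_topology S k G TG" and Hsub: "subgroup H G"
    and \<iota>def: "def_map S k m (carrier G) \<iota>"
    and \<iota>coset: "\<forall>g\<in>carrier G. \<forall>h\<in>carrier G. \<iota> g = \<iota> h \<longleftrightarrow> g <# H = h <# H"
    and \<tau>man: "def_manifold S m n (\<iota> ` carrier G) \<tau>"
    and \<tau>act: "continuous_map (prod_topology TG \<tau>) \<tau> (\<lambda>(g, y). \<iota> (g \<otimes> inv_into (carrier G) \<iota> y))"
  shows "\<tau> = quot_top TG \<iota>"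
proof -
  have gr: "group G" and tg: "is_topgroup TG (\<lambda>x y. x \<otimes> y) (\<lambda>x. inv x)"
    using GT unfolding def_group_topology_def def_group_def by auto
  obtain d where Gman: "def_manifold S k d (carrier G) TG"
    using GT unfolding def_group_topology_def by auto
  interpret coset_map G H \<iota>
    using gr Hsub \<iota>coset by (simp add: coset_map_def coset_map_axioms_def)
  define X where "X = \<iota> ` carrier G"
  have tG: "topspace TG = carrier G" and tX: "topspace \<tau> = X"
    using Gman \<tau>man unfolding def_manifold_def X_def by auto
  define L where "L g y = \<iota> (g \<otimes> rep y)" for g y
  have L: "L g (\<iota> a) = \<iota> (g \<otimes> a)" if "g \<in> carrier G" "a \<in> carrier G" for g a
    unfolding L_def using \<iota>_mult_rep that by blast
  have act: "continuous_map (prod_topology TG \<tau>) \<tau> (\<lambda>(g, y). L g y)"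
    using \<tau>act unfolding L_def .
  have actg: "continuous_map \<tau> \<tau> (L g)" if "g \<in> carrier G" for g
  proof -
    have "continuous_map \<tau> (prod_topology TG \<tau>) (\<lambda>y. (g, y))"
      using that tG by (intro continuous_map_pairedI) auto
    from continuous_map_compose[OF this act] show ?thesis by (simp add: o_def)
  qed
  have cont: "continuous_map TG \<tau> \<iota>"
  proof -
    have "continuous_map TG (prod_topology TG \<tau>) (\<lambda>g. (g, \<iota> \<one>))"
      using tX unfolding X_def by (intro continuous_map_pairedI) auto
    from continuous_map_compose[OF this act] have "continuous_map TG \<tau> (\<lambda>g. L g (\<iota> \<one>))"
      by (simp add: o_def)
    then show ?thesis by (rule continuous_map_eq) (simp add: L tG)
  qed
  obtain s where s: "def_map S m k X s" "\<And>y. y \<in> X \<Longrightarrow> s y \<in> carrier G \<and> \<iota> (s y) = y"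
    using def_map_section[OF \<iota>def] unfolding X_def by blast
  have "s ` X \<subseteq> carrier G" "X \<noteq> {}" using s(2) unfolding X_def by auto
  from def_map_continuity_point[OF \<tau>man[folded X_def] Gman s(1) this]
  obtain x0 where x0: "x0 \<in> X"
    "\<And>V. openin TG V \<Longrightarrow> s x0 \<in> V \<Longrightarrow> \<exists>W. openin \<tau> W \<and> x0 \<in> W \<and> s ` W \<subseteq> V" by blast
  have opn: "openin \<tau> (\<iota> ` U)" if U: "openin TG U" for U
  proof (subst openin_subopen, intro ballI)
    fix x assume "x \<in> \<iota> ` U"
    then obtain g' where g': "g' \<in> U" "x = \<iota> g'" by auto
    have UG: "U \<subseteq> carrier G" using openin_subset[OF U] tG by auto
    define g where "g = s x0"
    define c where "c = g' \<otimes> inv g"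
    have g: "g \<in> carrier G" "\<iota> g = x0" using s(2)[OF x0(1)] unfolding g_def by auto
    have g'G: "g' \<in> carrier G" using UG g' by auto
    have c: "c \<in> carrier G" "c \<otimes> g = g'" "inv c \<otimes> g' = g"
      unfolding c_def using g g'G by (auto simp: m_assoc inv_mult_group)
    have "openin TG {y \<in> topspace TG. c \<otimes> y \<in> U}"
      using openin_continuous_map_preimage[OF continuous_map_left_mult[OF tg] U] c tG by blast
    moreover have "s x0 \<in> {y \<in> topspace TG. c \<otimes> y \<in> U}" using g c g' tG unfolding g_def by auto
    ultimately obtain W where W: "openin \<tau> W" "x0 \<in> W" "s ` W \<subseteq> {y \<in> topspace TG. c \<otimes> y \<in> U}"
      using x0(2) by blast
    \<comment> \<open>The translate of W by c, a neighbourhood of x, since \<open>inv c\<close>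
      takes x back to x0.\<close>
    let ?T = "{y \<in> topspace \<tau>. L (inv c) y \<in> W}"
    have "openin \<tau> ?T" using openin_continuous_map_preimage[OF actg W(1)] c by blast
    moreover have "x \<in> ?T" using g' g'G L c g W(2) tX unfolding X_def by auto
    moreover have "?T \<subseteq> \<iota> ` U"
    proof
      fix y assume y: "y \<in> ?T"
      then obtain a where a: "a \<in> carrier G" "y = \<iota> a" using tX unfolding X_def by auto
      then have w: "\<iota> (inv c \<otimes> a) \<in> W" using y L c by auto
      \<comment> \<open>The section picks a representative b of the coset of
        \<open>inv c \<otimes> a\<close> that c moves into U; then \<open>c \<otimes> b\<close> lies
        in U and represents y.\<close>
      define b where "b = s (\<iota> (inv c \<otimes> a))"
      have b: "b \<in> carrier G" "\<iota> b = \<iota> (inv c \<otimes> a)"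
        using s(2)[of "\<iota> (inv c \<otimes> a)"] a c unfolding b_def X_def by auto
      have "\<iota> (c \<otimes> b) = \<iota> (c \<otimes> (inv c \<otimes> a))" using b a c by (intro \<iota>_mult_left) auto
      also have "c \<otimes> (inv c \<otimes> a) = a" using a c by (simp add: m_assoc[symmetric])
      finally have "\<iota> (c \<otimes> b) = y" using a by simp
      moreover have "c \<otimes> b \<in> U" using w W(3) unfolding b_def by auto
      ultimately show "y \<in> \<iota> ` U" by blast
    qed
    ultimately show "\<exists>T. openin \<tau> T \<and> x \<in> T \<and> T \<subseteq> \<iota> ` U" by blast
  qed
  show ?thesis unfolding topology_eq openin_quot_top
  proof (intro allI iffI)
    fix U assume "openin \<tau> U"
    then show "U \<subseteq> \<iota> ` topspace TG \<and> openin TG {x \<in> topspace TG. \<iota> x \<in> U}"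
      using openin_subset[of \<tau> U] tX tG openin_continuous_map_preimage[OF cont] unfolding X_def by auto
  next
    fix U assume U: "U \<subseteq> \<iota> ` topspace TG \<and> openin TG {x \<in> topspace TG. \<iota> x \<in> U}"
    then have "U = \<iota> ` {x \<in> topspace TG. \<iota> x \<in> U}" by auto
    then show "openin \<tau> U" using opn U by metis
  qed
qed

text \<open>The action is multiplication in the quotient group after \<iota> on the first factor,
  hence continuous once \<iota> is. Continuity of \<iota> spreads from one point because
  \<open>\<iota> x\<close> is the product of \<open>\<iota> c\<close> and
  \<open>\<iota> (inv c \<otimes> x)\<close>, and left multiplication is continuous in both
  groups.\<close>

lemma quot_group_action_continuous:
  fixes G :: "'a tup monoid" (structure)
  assumes GT: "def_group_topology S k G TG" and normal: "H \<lhd> G"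
    and \<iota>def: "def_map S k m (carrier G) \<iota>"
    and \<iota>coset: "\<forall>g\<in>carrier G. \<forall>h\<in>carrier G. \<iota> g = \<iota> h \<longleftrightarrow> g <# H = h <# H"
    and QT: "def_group_topology S m (quot_group G \<iota>) T"
  shows "continuous_map (prod_topology TG T) T (\<lambda>(g, y). \<iota> (g \<otimes> inv_into (carrier G) \<iota> y))"
proof -
  have gr: "group G" and tg: "is_topgroup TG (\<lambda>x y. x \<otimes> y) (\<lambda>x. inv x)"
    using GT unfolding def_group_topology_def def_group_def by auto
  obtain d where Gman: "def_manifold S k d (carrier G) TG"
    using GT unfolding def_group_topology_def by auto
  have Hsub: "subgroup H G" using normal by (rule normal_imp_subgroup)
  interpret coset_map G H \<iota>
    using gr Hsub \<iota>coset by (simp add: coset_map_def coset_map_axioms_def)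
  define Q where "Q = quot_group G \<iota>"
  have cQ: "carrier Q = \<iota> ` carrier G" unfolding Q_def quot_group_def by simp
  have tq: "is_topgroup T (\<lambda>x y. x \<otimes>\<^bsub>Q\<^esub> y) (\<lambda>x. inv\<^bsub>Q\<^esub> x)"
    using QT unfolding def_group_topology_def Q_def by auto
  obtain n where Qman: "def_manifold S m n (\<iota> ` carrier G) T"
    using QT cQ unfolding def_group_topology_def Q_def by auto
  have tG: "topspace TG = carrier G" and tQ: "topspace T = \<iota> ` carrier G"
    using Gman Qman unfolding def_manifold_def by auto
  have Qmult: "\<iota> a \<otimes>\<^bsub>Q\<^esub> \<iota> b = \<iota> (a \<otimes> b)" if "a \<in> carrier G" "b \<in> carrier G" for a b
    unfolding Q_def using \<iota>_mult_quot[OF normal that] .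
  have "carrier G \<noteq> {}" by auto
  from def_map_continuity_point[OF Gman Qman \<iota>def subset_refl this]
  obtain x0 where x0: "x0 \<in> carrier G"
    "\<And>V. openin T V \<Longrightarrow> \<iota> x0 \<in> V \<Longrightarrow> \<exists>W. openin TG W \<and> x0 \<in> W \<and> \<iota> ` W \<subseteq> V" by blast
  have "openin TG {x \<in> topspace TG. \<iota> x \<in> V}" if V: "openin T V" for V
  proof (subst openin_subopen, intro ballI)
    fix g assume "g \<in> {x \<in> topspace TG. \<iota> x \<in> V}"
    then have g: "g \<in> carrier G" "\<iota> g \<in> V" using tG by auto
    define c where "c = g \<otimes> inv x0"
    have c: "c \<in> carrier G" "c \<otimes> x0 = g" "inv c \<otimes> g = x0"
      unfolding c_def using g x0(1) by (auto simp: m_assoc inv_mult_group)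
    have "\<iota> c \<in> topspace T" using c(1) unfolding tQ by blast
    from openin_continuous_map_preimage[OF continuous_map_left_mult[OF tq this] V]
    have "openin T {y \<in> topspace T. \<iota> c \<otimes>\<^bsub>Q\<^esub> y \<in> V}" .
    moreover have "\<iota> x0 \<in> {y \<in> topspace T. \<iota> c \<otimes>\<^bsub>Q\<^esub> y \<in> V}"
      using x0(1) Qmult[OF c(1) x0(1)] g c unfolding tQ by auto
    ultimately obtain W where W: "openin TG W" "x0 \<in> W" "\<iota> ` W \<subseteq> {y \<in> topspace T. \<iota> c \<otimes>\<^bsub>Q\<^esub> y \<in> V}"
      using x0(2) by blast
    let ?U = "{x \<in> topspace TG. inv c \<otimes> x \<in> W}"
    have "openin TG ?U"
      using openin_continuous_map_preimage[OF continuous_map_left_mult[OF tg] W(1)] c tG by auto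
    moreover have "g \<in> ?U" using g c W tG by auto
    moreover have "?U \<subseteq> {x \<in> topspace TG. \<iota> x \<in> V}"
    proof
      fix x assume x: "x \<in> ?U"
      then have xG: "x \<in> carrier G" using tG by auto
      have "\<iota> c \<otimes>\<^bsub>Q\<^esub> \<iota> (inv c \<otimes> x) \<in> V" using x W(3) by auto
      moreover have "c \<otimes> (inv c \<otimes> x) = x" using xG c by (simp add: m_assoc[symmetric])
      ultimately show "x \<in> {x \<in> topspace TG. \<iota> x \<in> V}" using Qmult[of c "inv c \<otimes> x"] xG c tG by auto
    qed
    ultimately show "\<exists>U. openin TG U \<and> g \<in> U \<and> U \<subseteq> {x \<in> topspace TG. \<iota> x \<in> V}" by blast
  qed
  then have cont: "continuous_map TG T \<iota>" unfolding continuous_map using tG tQ by auto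
  have "continuous_map (prod_topology TG T) (prod_topology T T) (\<lambda>z. (\<iota> (fst z), snd z))"
    using continuous_map_compose[OF continuous_map_fst cont, of T]
    by (intro continuous_map_pairedI continuous_map_snd) (simp add: o_def)
  from continuous_map_compose[OF this, of T "\<lambda>(x, y). x \<otimes>\<^bsub>Q\<^esub> y"]
  have "continuous_map (prod_topology TG T) T (\<lambda>z. \<iota> (fst z) \<otimes>\<^bsub>Q\<^esub> snd z)"
    using tq unfolding is_topgroup_def by (simp add: o_def)
  then show ?thesis
    by (rule continuous_map_eq) (auto simp: tG tQ Qmult \<iota>_mult_rep)
qed

end

theorem theorem4p3:
  fixes S :: "nat \<Rightarrow> 'a::linordered_field tup set set"
    and G :: "'a tup monoid" and H :: "'a tup set"
    and k m :: nat and TG :: "'a tup topology" and \<iota> :: "'a tup \<Rightarrow> 'a tup"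
    and \<tau> :: "'a tup topology"
  assumes omin: "o_minimal_expansion_rcf S"
    and GT: "def_group_topology S k G TG"
    and Hdef: "H \<in> S k" and Hsub: "subgroup H G"
    and \<iota>def: "def_map S k m (carrier G) \<iota>"
    and \<iota>coset: "\<forall>g\<in>carrier G. \<forall>h\<in>carrier G. \<iota> g = \<iota> h \<longleftrightarrow> g <#\<^bsub>G\<^esub> H = h <#\<^bsub>G\<^esub> H"
    and \<tau>man: "\<exists>n. def_manifold S m n (\<iota> ` carrier G) \<tau>"
    and \<tau>act: "continuous_map (prod_topology TG \<tau>) \<tau>
                 (\<lambda>(g, y). \<iota> (g \<otimes>\<^bsub>G\<^esub> inv_into (carrier G) \<iota> y))"
  shows "\<tau> = quot_top TG \<iota> \<and>
         (H \<lhd> G \<longrightarrow> (\<forall>T'. def_group_topology S m (quot_group G \<iota>) T' \<longrightarrow> T' = quot_top TG \<iota>))"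
proof (intro conjI impI allI)
  interpret omin_field S using omin by unfold_locales
  show "\<tau> = quot_top TG \<iota>"
    using \<tau>man quotient_topology_unique[OF GT Hsub \<iota>def \<iota>coset _ \<tau>act] by blast
  fix T' assume N: "H \<lhd> G" and T': "def_group_topology S m (quot_group G \<iota>) T'"
  then obtain n where "def_manifold S m n (\<iota> ` carrier G) T'"
    unfolding def_group_topology_def quot_group_def by auto
  from quotient_topology_unique[OF GT Hsub \<iota>def \<iota>coset this]
  show "T' = quot_top TG \<iota>"
    using quot_group_action_continuous[OF GT N \<iota>def \<iota>coset T'] .
qed

end
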